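(* Let $(X_n)_{n\geq -1}$ be a second-order Galton--Watson process with immigration with generic offspring variables $\xi,\eta$ and generic immigration variable $\varepsilon$, such that $X_0$ and $X_{-1}$ are regularly varying with index $\beta \in [0,\infty)$, and there exists $r \in (\max(1,\beta),\infty)$ with $\mathbb{E}(\xi^r)<\infty$, $\mathbb{E}(\eta^r)<\infty$ and $\mathbb{E}(\varepsilon^r)<\infty$. Suppose that $\mathbb{P}(\xi=0)<1$ or $\mathbb{P}(\eta=0)<1$. Then for all $n\in\mathbb{N}$, \[ \mathbb{P}(X_n > x) \sim m_n^\beta\, \mathbb{P}(X_0>x) + m_{n-1}^\beta m_\eta^\beta\, \mathbb{P}(X_{-1}>x) \qquad \text{as } x\to\infty, \] yielding that $X_n$ is regularly varying with index $\beta$.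
   Context: A second-order Galton--Watson process with immigration $(X_n)_{n\geq -1}$ is defined by $X_n = \sum_{i=1}^{X_{n-1}} \xi_{n,i} + \sum_{j=1}^{X_{n-2}} \eta_{n,j} + \varepsilon_n$ for $n\in\mathbb{N}=\{1,2,\dots\}$, where $X_{-1}, X_0$ (initial values) and all $\xi_{n,i},\eta_{n,j},\varepsilon_n$ ($n,i,j\in\mathbb{N}$) are independent non-negative integer-valued random variables, the $\xi_{n,i}$ are identically distributed with generic copy $\xi$, the $\eta_{n,j}$ identically distributed with generic copy $\eta$, and the $\varepsilon_n$ identically distributed with generic copy $\varepsilon$. Write $m_\xi=\mathbb{E}(\xi)$, $m_\eta=\mathbb{E}(\eta)$. Set $m_0:=1$ and for $k\in\mathbb{N}$, $m_k := \frac{\lambda_+^{k+1}-\lambda_-^{k+1}}{\lambda_+-\lambda_-}$ with $\lambda_\pm := \frac{m_\xi \pm \sqrt{m_\xi^2+4m_\eta}}{2}$. A non-negative random variable $X$ is regularly varying with index $\alpha\geq 0$ if $\lim_{x\to\infty}\mathbb{P}(X>qx)/\mathbb{P}(X>x) = q^{-\alpha}$ for all $q>0$. $f\sim g$ means $f(x)/g(x)\to 1$ as $x\to\infty$.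
   Formalization: The powers m_n^β, m_{n-1}^β and m_η^β are read with 0^0 = 0; with 0^0 = 1 the claim fails for β = 0 when a coefficient vanishes, e.g. η = 0, ξ = 1, ε = 0, where X_n = X_0 does not depend on X_{-1}. *)

theory Defs
  imports "HOL-Probability.Probability" "HOL-Library.Landau_Symbols"
begin

datatype gwi_index = I_Xm1 | I_X0 | I_xi nat nat | I_eta nat nat | I_eps nat

definition gwi_indices :: "gwi_index set" where
  "gwi_indices = {I_Xm1, I_X0} \<union> {I_xi n i | n i. 1 \<le> n \<and> 1 \<le> i}
     \<union> {I_eta n j | n j. 1 \<le> n \<and> 1 \<le> j} \<union> {I_eps n | n. 1 \<le> n}"

definition gwi_family ::
  "('a \<Rightarrow> nat) \<Rightarrow> ('a \<Rightarrow> nat) \<Rightarrow> (nat \<Rightarrow> nat \<Rightarrow> 'a \<Rightarrow> nat)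
   \<Rightarrow> (nat \<Rightarrow> nat \<Rightarrow> 'a \<Rightarrow> nat) \<Rightarrow> (nat \<Rightarrow> 'a \<Rightarrow> nat) \<Rightarrow> gwi_index \<Rightarrow> 'a \<Rightarrow> nat" where
  "gwi_family Xm1 X0 xi eta eps i = (case i of
      I_Xm1 \<Rightarrow> Xm1 | I_X0 \<Rightarrow> X0 | I_xi n k \<Rightarrow> xi n k | I_eta n k \<Rightarrow> eta n k | I_eps n \<Rightarrow> eps n)"

text \<open>Shifted process: gwi_shift ... k = X_{k-1}, i.e. index 0 is X_{-1},
index 1 is X_0, and index (n+1) is X_n.\<close>
fun gwi_shift ::
  "('a \<Rightarrow> nat) \<Rightarrow> ('a \<Rightarrow> nat) \<Rightarrow> (nat \<Rightarrow> nat \<Rightarrow> 'a \<Rightarrow> nat)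
   \<Rightarrow> (nat \<Rightarrow> nat \<Rightarrow> 'a \<Rightarrow> nat) \<Rightarrow> (nat \<Rightarrow> 'a \<Rightarrow> nat) \<Rightarrow> nat \<Rightarrow> 'a \<Rightarrow> nat" where
  "gwi_shift Xm1 X0 xi eta eps 0 \<omega> = Xm1 \<omega>"
| "gwi_shift Xm1 X0 xi eta eps (Suc 0) \<omega> = X0 \<omega>"
| "gwi_shift Xm1 X0 xi eta eps (Suc (Suc k)) \<omega> =
     (\<Sum>i = 1..gwi_shift Xm1 X0 xi eta eps (Suc k) \<omega>. xi (Suc k) i \<omega>)
   + (\<Sum>j = 1..gwi_shift Xm1 X0 xi eta eps k \<omega>. eta (Suc k) j \<omega>)
   + eps (Suc k) \<omega>"

definition gwi_X ::
  "('a \<Rightarrow> nat) \<Rightarrow> ('a \<Rightarrow> nat) \<Rightarrow> (nat \<Rightarrow> nat \<Rightarrow> 'a \<Rightarrow> nat)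
   \<Rightarrow> (nat \<Rightarrow> nat \<Rightarrow> 'a \<Rightarrow> nat) \<Rightarrow> (nat \<Rightarrow> 'a \<Rightarrow> nat) \<Rightarrow> int \<Rightarrow> 'a \<Rightarrow> nat" where
  "gwi_X Xm1 X0 xi eta eps n = gwi_shift Xm1 X0 xi eta eps (nat (n + 1))"

definition lam_plus :: "real \<Rightarrow> real \<Rightarrow> real" where
  "lam_plus mxi meta = (mxi + sqrt (mxi\<^sup>2 + 4 * meta)) / 2"

definition lam_minus :: "real \<Rightarrow> real \<Rightarrow> real" where
  "lam_minus mxi meta = (mxi - sqrt (mxi\<^sup>2 + 4 * meta)) / 2"

definition mseq :: "real \<Rightarrow> real \<Rightarrow> nat \<Rightarrow> real" where
  "mseq mxi meta k = (if k = 0 then 1 else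
     (lam_plus mxi meta ^ (k + 1) - lam_minus mxi meta ^ (k + 1))
       / (lam_plus mxi meta - lam_minus mxi meta))"

definition regvar :: "'a measure \<Rightarrow> ('a \<Rightarrow> real) \<Rightarrow> real \<Rightarrow> bool" where
  "regvar M X \<alpha> \<longleftrightarrow> \<alpha> \<ge> 0 \<and> (\<forall>q>0.
     ((\<lambda>x. measure M {\<omega> \<in> space M. X \<omega> > q * x} / measure M {\<omega> \<in> space M. X \<omega> > x})
        \<longlongrightarrow> q powr (- \<alpha>)) at_top)"

end

theory Submission
  imports Defs
begin

text \<open>
  Let \<open>Y\<^sub>n\<close> solve the mean recursion \<open>Y\<^sub>n = m\<^sub>\<xi> Y\<^sub>n\<^sub>-\<^sub>1 + m\<^sub>\<eta> Y\<^sub>n\<^sub>-\<^sub>2\<close> with \<open>Y\<^sub>0 = X\<^sub>0\<close> and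
  \<open>Y\<^sub>-\<^sub>1 = X\<^sub>-\<^sub>1\<close>; it is a nonnegative linear combination of the two independent initial values, so
  its tail is known by the one-big-jump principle. The process stays close to \<open>Y\<^sub>n\<close>:
  for every \<open>\<delta> > 0\<close> the event \<open>\<bar>X\<^sub>n - Y\<^sub>n\<bar> > \<delta> (x + Y\<^sub>n)\<close> has probability \<open>o(P(Y\<^sub>n > x))\<close>.
  This is shown by induction on \<open>n\<close>, since \<open>X\<^sub>n - Y\<^sub>n\<close> is \<open>m\<^sub>\<xi>(X\<^sub>n\<^sub>-\<^sub>1 - Y\<^sub>n\<^sub>-\<^sub>1) + m\<^sub>\<eta>(X\<^sub>n\<^sub>-\<^sub>2 - Y\<^sub>n\<^sub>-\<^sub>2)\<close>
  plus the immigration and two centred random sums whose numbers of terms are independent of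
  the summands. The centred sums are controlled by Markov's inequality with the moment bound
  \<open>E\<bar>S\<^sub>k\<bar>\<^sup>r \<le> C k\<^sup>p\<close>, \<open>p < r\<close>, and a truncated moment estimate for the number of terms.
\<close>

section \<open>Regularly varying tails\<close>

text \<open>Only a moment of order r > 1 is available, possibly with r < 2, so variances cannot be
  used; and since \<beta> may be 0, the number N of terms may have no finite moment of positive
  order, so conditioning on N cannot end in an untruncated moment of N. Both obstacles shape the
  random sum estimate. Its exponent p is 1 for r <= 2 and r - 1 for r > 2. For r > 2 this is cruder
  than the classical r / 2, but p < r is enough: it leaves room for some p' with max \<beta> p < p'
  < r. For p' > \<beta> the moment of order p' of min(N, x) is at most of order x^p' P(Y_n > x), and
  Markov's factor x^(-r) turns this into x^(p' - r) P(Y_n > x), which is negligible. The condition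
  P(xi = 0) < 1 or P(eta = 0) < 1 makes one of the two means positive; this keeps at least one
  coefficient of every Y_n positive, so that Y_n has a regularly varying tail to compare
  with.\<close>

definition rv_tail :: "real \<Rightarrow> (real \<Rightarrow> real) \<Rightarrow> bool" where
  "rv_tail \<beta> f \<longleftrightarrow> 0 \<le> \<beta> \<and> antimono f \<and> (\<forall>x. 0 < f x) \<and> (f \<longlongrightarrow> 0) at_top \<and>
     (\<forall>q>0. ((\<lambda>x. f (q * x) / f x) \<longlongrightarrow> q powr (- \<beta>)) at_top)"

lemma rv_tailD:
  assumes "rv_tail \<beta> f"
  shows "0 \<le> \<beta>" "antimono f" "0 < f x" "(f \<longlongrightarrow> 0) at_top"
    "q > 0 \<Longrightarrow> ((\<lambda>x. f (q * x) / f x) \<longlongrightarrow> q powr (- \<beta>)) at_top"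
    "x \<le> y \<Longrightarrow> f y \<le> f x"
  using assms unfolding rv_tail_def by (auto dest: antimonoD)

lemma filterlim_scale_at_top:
  fixes c :: real
  assumes "c > 0"
  shows "filterlim (\<lambda>x. c * x) at_top at_top"
  using assms by (intro filterlim_tendsto_pos_mult_at_top[OF tendsto_const]) (auto simp: filterlim_ident)

lemma rv_tail_scale_equiv:
  assumes f: "rv_tail \<beta> f" and c: "c > 0"
  shows "(\<lambda>x. f (c * x)) \<sim>[at_top] (\<lambda>x. c powr (- \<beta>) * f x)"
proof (rule asymp_equivI')
  have "((\<lambda>x. (f (c * x) / f x) / c powr (- \<beta>)) \<longlongrightarrow> c powr (- \<beta>) / c powr (- \<beta>)) at_top"
    using c by (intro tendsto_divide rv_tailD(5)[OF f] tendsto_const) auto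
  thus "((\<lambda>x. f (c * x) / (c powr (- \<beta>) * f x)) \<longlongrightarrow> 1) at_top"
    using c by (simp add: mult.commute)
qed

lemma rv_tail_scale_bigo:
  assumes f: "rv_tail \<beta> f" and c: "c > 0"
  shows "(\<lambda>x. f (c * x)) \<in> O[at_top](f)"
proof -
  have "(\<lambda>x. f (c * x)) \<in> O[at_top](\<lambda>x. c powr (- \<beta>) * f x)"
    using rv_tail_scale_equiv[OF assms] by (rule asymp_equiv_imp_bigo)
  thus ?thesis using c by simp
qed

lemma rv_tail_scale:
  assumes f: "rv_tail \<beta> f" and c: "c > 0"
  shows "rv_tail \<beta> (\<lambda>x. f (c * x))"
  unfolding rv_tail_def
proof (intro conjI allI impI)
  show "0 \<le> \<beta>" "0 < f (c * x)" for x using rv_tailD[OF f] by auto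
  show "antimono (\<lambda>x. f (c * x))"
    using c by (intro antimonoI rv_tailD(6)[OF f]) (auto intro: mult_left_mono)
  show "((\<lambda>x. f (c * x)) \<longlongrightarrow> 0) at_top"
    by (rule filterlim_compose[OF rv_tailD(4)[OF f] filterlim_scale_at_top[OF c]])
  fix q :: real assume q: "q > 0"
  have "((\<lambda>x. f (q * (c * x)) / f (c * x)) \<longlongrightarrow> q powr (- \<beta>)) at_top"
    by (rule filterlim_compose[OF rv_tailD(5)[OF f q] filterlim_scale_at_top[OF c]])
  thus "((\<lambda>x. f (c * (q * x)) / f (c * x)) \<longlongrightarrow> q powr (- \<beta>)) at_top"
    by (simp add: mult_ac)
qed

text \<open>Nonnegativity rules out cancellation: F and G are both O(F + G), so errors o(F) and o(G)
  add up to o(F + G).\<close>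

lemma add_asymp_equiv:
  fixes f g F G :: "real \<Rightarrow> real"
  assumes "f \<sim>[at_top] F" "g \<sim>[at_top] G" "\<And>x. F x \<ge> 0" "\<And>x. G x \<ge> 0"
  shows "(\<lambda>x. f x + g x) \<sim>[at_top] (\<lambda>x. F x + G x)"
proof -
  have 1: "F \<in> O[at_top](\<lambda>x. F x + G x)" "G \<in> O[at_top](\<lambda>x. F x + G x)"
    by (intro bigoI[of _ 1] always_eventually allI; use assms(3,4) in simp)+
  have "(\<lambda>x. f x - F x) \<in> o[at_top](F)" "(\<lambda>x. g x - G x) \<in> o[at_top](G)"
    using assms(1,2) by (auto simp: asymp_equiv_altdef)
  hence "(\<lambda>x. (f x - F x) + (g x - G x)) \<in> o[at_top](\<lambda>x. F x + G x)"
    by (intro sum_in_smallo(1)[OF landau_o.small_big_trans[OF _ 1(1)] landau_o.small_big_trans[OF _ 1(2)]])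
  thus ?thesis unfolding asymp_equiv_altdef by (simp add: algebra_simps)
qed

lemma rv_tail_add:
  assumes f: "rv_tail \<beta> f" and g: "rv_tail \<beta> g"
  shows "rv_tail \<beta> (\<lambda>x. f x + g x)"
  unfolding rv_tail_def
proof (intro conjI allI impI)
  note fp = rv_tailD(3)[OF f] and gp = rv_tailD(3)[OF g]
  show "0 \<le> \<beta>" "0 < f x + g x" for x using rv_tailD(1)[OF f] add_pos_pos[OF fp[of x] gp[of x]] by auto
  show "antimono (\<lambda>x. f x + g x)"
    by (intro antimonoI add_mono rv_tailD(6)[OF f] rv_tailD(6)[OF g])
  show "((\<lambda>x. f x + g x) \<longlongrightarrow> 0) at_top"
    using tendsto_add[OF rv_tailD(4)[OF f] rv_tailD(4)[OF g]] by simp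
  fix q :: real assume q: "q > 0"
  have "(\<lambda>x. f (q * x) + g (q * x)) \<sim>[at_top]
          (\<lambda>x. q powr (- \<beta>) * f x + q powr (- \<beta>) * g x)"
    by (intro add_asymp_equiv rv_tail_scale_equiv f g q mult_nonneg_nonneg)
       (auto intro: less_imp_le fp gp)
  hence "((\<lambda>x. (f (q * x) + g (q * x)) / (q powr (- \<beta>) * f x + q powr (- \<beta>) * g x)) \<longlongrightarrow> 1) at_top"
    by (rule asymp_equivD_strong) (use q fp gp in \<open>auto intro!: always_eventually simp: add_pos_pos less_imp_neq[symmetric]\<close>)
  hence "((\<lambda>x. q powr (- \<beta>) * ((f (q * x) + g (q * x)) / (q powr (- \<beta>) * f x + q powr (- \<beta>) * g x)))
           \<longlongrightarrow> q powr (- \<beta>) * 1) at_top"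
    by (intro tendsto_intros)
  moreover have "q powr (- \<beta>) * ((f (q * x) + g (q * x)) / (q powr (- \<beta>) * f x + q powr (- \<beta>) * g x))
      = (f (q * x) + g (q * x)) / (f x + g x)" for x
    using q by (simp flip: distrib_left)
  ultimately show "((\<lambda>x. (f (q * x) + g (q * x)) / (f x + g x)) \<longlongrightarrow> q powr (- \<beta>)) at_top"
    by simp
qed

lemma rv_ratio_of_asymp_equiv:
  assumes f: "rv_tail \<beta> f" and g: "g \<sim>[at_top] f" and q: "q > 0"
  shows "((\<lambda>x. g (q * x) / g x) \<longlongrightarrow> q powr (- \<beta>)) at_top"
proof -
  have "((\<lambda>x. g x / f x) \<longlongrightarrow> 1) at_top"
    by (rule asymp_equivD_strong[OF g])
       (use rv_tailD(3)[OF f] in \<open>auto intro!: always_eventually simp: less_imp_neq[symmetric]\<close>)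
  note l1 = this
  note l2 = filterlim_compose[OF l1 filterlim_scale_at_top[OF q]]
  have "((\<lambda>x. (g (q * x) / f (q * x)) * (f (q * x) / f x) / (g x / f x)) \<longlongrightarrow> 1 * q powr (- \<beta>) / 1) at_top"
    by (intro tendsto_intros l1 l2 rv_tailD(5)[OF f q]) auto
  moreover have "(g (q * x) / f (q * x)) * (f (q * x) / f x) / (g x / f x) = g (q * x) / g x" for x
    using rv_tailD(3)[OF f, of x] rv_tailD(3)[OF f, of "q*x"] by (simp add: field_simps)
  ultimately show ?thesis by (simp only:) simp
qed

text \<open>Regular variation converts the factor q in the argument into a factor
  \<open>q powr \<beta>\<close> or \<open>q powr (- \<beta>)\<close>, and both tend to 1 as q
  decreases to 1. The error \<open>e\<close> may depend on q, because q is fixed before x tends to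
  infinity.\<close>

lemma rv_tail_sandwich:
  assumes f: "rv_tail \<beta> f"
    and up: "\<And>q. q > 1 \<Longrightarrow> \<exists>e\<in>o[at_top](f). eventually (\<lambda>x. g x \<le> f (x / q) + e x) at_top"
    and lo: "\<And>q. q > 1 \<Longrightarrow> \<exists>e\<in>o[at_top](f). eventually (\<lambda>x. f (q * x) - e x \<le> g x) at_top"
  shows "g \<sim>[at_top] f"
proof (rule asymp_equivI')
  have lim: "((\<lambda>q. q powr b) \<longlongrightarrow> 1) (at_right (1::real))" for b :: real
  proof -
    have "((\<lambda>q. q powr b) \<longlongrightarrow> 1 powr b) (at_right (1::real))"
      by (intro tendsto_intros) auto
    thus ?thesis by simp
  qed
  note fp = rv_tailD(3)[OF f]
  show "((\<lambda>x. g x / f x) \<longlongrightarrow> 1) at_top"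
  proof (rule order_tendstoI)
    fix a :: real assume a: "a < 1"
    have "eventually (\<lambda>q. q powr (- \<beta>) > a \<and> q > 1) (at_right (1::real))"
      using order_tendstoD(1)[OF lim a] eventually_at_right_less by eventually_elim auto
    then obtain q where q: "q powr (- \<beta>) > a" "q > 1"
      by (auto dest!: eventually_happens'[rotated])
    from lo[OF q(2)] obtain e where e: "e \<in> o[at_top](f)"
      "eventually (\<lambda>x. f (q * x) - e x \<le> g x) at_top" by auto
    have "((\<lambda>x. f (q * x) / f x - e x / f x) \<longlongrightarrow> q powr (- \<beta>) - 0) at_top"
      using q by (intro tendsto_intros rv_tailD(5)[OF f] smalloD_tendsto e) auto
    hence "eventually (\<lambda>x. f (q * x) / f x - e x / f x > a) at_top"
      using q by (intro order_tendstoD) auto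
    thus "eventually (\<lambda>x. a < g x / f x) at_top"
      using e(2)
    proof eventually_elim
      case (elim x)
      have "f (q * x) / f x - e x / f x \<le> g x / f x"
        using elim fp[of x] by (simp add: divide_right_mono flip: diff_divide_distrib)
      thus ?case using elim by simp
    qed
  next
    fix a :: real assume a: "1 < a"
    have "eventually (\<lambda>q. q powr \<beta> < a \<and> q > 1) (at_right (1::real))"
      using order_tendstoD(2)[OF lim a] eventually_at_right_less by eventually_elim auto
    then obtain q where q: "q powr \<beta> < a" "q > 1"
      by (auto dest!: eventually_happens'[rotated])
    from up[OF q(2)] obtain e where e: "e \<in> o[at_top](f)"
      "eventually (\<lambda>x. g x \<le> f (x / q) + e x) at_top" by auto
    have "((\<lambda>x. f (1 / q * x) / f x + e x / f x) \<longlongrightarrow> (1 / q) powr (- \<beta>) + 0) at_top"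
      using q by (intro tendsto_intros rv_tailD(5)[OF f] smalloD_tendsto e) auto
    hence "eventually (\<lambda>x. f (1 / q * x) / f x + e x / f x < a) at_top"
      using q by (intro order_tendstoD) (auto simp: powr_minus powr_divide field_simps)
    thus "eventually (\<lambda>x. g x / f x < a) at_top"
      using e(2)
    proof eventually_elim
      case (elim x)
      have "g x / f x \<le> f (1 / q * x) / f x + e x / f x"
        using elim fp[of x] by (simp add: divide_right_mono flip: add_divide_distrib)
      thus ?case using elim by simp
    qed
  qed
qed

text \<open>A substitute for Karamata's theorem and Potter's bounds that needs no integration.\<close>

lemma rv_tail_dyadic_bound:
  fixes W :: "real \<Rightarrow> real"
  assumes f: "rv_tail \<beta> f" and p: "\<beta> < p" and W: "mono W" "\<And>x. W x \<ge> 0"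
    and step: "eventually (\<lambda>x. W (2 * x) \<le> W x + C * (x powr p * f x)) at_top"
  shows "W \<in> O[at_top](\<lambda>x. x powr p * f x)"
proof -
  note fp = rv_tailD(3)[OF f]
  have p0: "p > 0" using rv_tailD(1)[OF f] p by simp
  \<comment> \<open>Any exponent strictly between \<beta> and p works: \<open>f (2 * x)\<close>
    eventually exceeds \<open>2 powr (- \<gamma>) * f x\<close>, so doubling x multiplies
    \<open>x powr p * f x\<close> by at least \<open>2 powr (p - \<gamma>) > 1\<close>, and the
    increments of \<open>W\<close> are dominated by a geometric growth.\<close>
  define \<gamma> where "\<gamma> = (\<beta> + p) / 2"
  have \<gamma>: "\<beta> < \<gamma>" "\<gamma> < p" using p by (auto simp: \<gamma>_def)
  have "eventually (\<lambda>x. f (2 * x) / f x > 2 powr (- \<gamma>)) at_top"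
    using \<gamma> by (intro order_tendstoD(1)[OF rv_tailD(5)[OF f]]) auto
  with step have "eventually (\<lambda>x. f (2 * x) / f x > 2 powr (- \<gamma>) \<and>
      W (2 * x) \<le> W x + C * (x powr p * f x)) at_top" by eventually_elim auto
  then obtain x1 where x1: "\<And>x. x \<ge> x1 \<Longrightarrow> f (2 * x) / f x > 2 powr (- \<gamma>)"
    "\<And>x. x \<ge> x1 \<Longrightarrow> W (2 * x) \<le> W x + C * (x powr p * f x)" "x1 \<ge> 1"
    unfolding eventually_at_top_linorder
    by (metis max.bounded_iff max.cobounded2)
  define l where "l = 2 powr (p - \<gamma>)"
  have l: "l > 1" using \<gamma> by (simp add: l_def)
  \<comment> \<open>The second entry covers the initial block from \<open>x1\<close> to
    \<open>2 * x1\<close>; the first gives \<open>K + C \<le> K * l\<close>, so that the bound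
    reproduces itself when x is doubled.\<close>
  define K where "K = max (C / (l - 1)) (W (2 * x1) / (x1 powr p * f (2 * x1)))"
  have K: "C / (l - 1) \<le> K" "W (2 * x1) / (x1 powr p * f (2 * x1)) \<le> K" by (auto simp: K_def)
  have K0: "K \<ge> 0" using K(2) W(2)[of "2*x1"] fp[of "2*x1"]
    by (smt (verit) divide_nonneg_nonneg mult_nonneg_nonneg powr_ge_zero)
  have KC: "K + C \<le> K * l" using K(1) l by (simp add: field_simps)
  have main: "W x \<le> K * (x powr p * f x)" if "x1 \<le> x" "x \<le> 2 ^ Suc j * x1" for j x
    using that
  proof (induction j arbitrary: x)
    case 0
    have "W x \<le> W (2 * x1)" using 0 by (intro monoD[OF W(1)]) auto
    also have "\<dots> \<le> K * (x1 powr p * f (2 * x1))"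
      using K(2) fp[of "2*x1"] x1(3) by (simp add: pos_divide_le_eq)
    also have "\<dots> \<le> K * (x powr p * f x)"
      using 0 x1(3) K0 p0 fp[of "2*x1"]
      by (intro mult_left_mono mult_mono powr_mono2 rv_tailD(6)[OF f]) (auto intro: less_imp_le fp)
    finally show ?case .
  next
    case (Suc j)
    show ?case
    proof (cases "x \<le> 2 ^ Suc j * x1")
      case True thus ?thesis using Suc by blast
    next
      case False
      define y where "y = x / 2"
      have xy: "x = 2 * y" by (simp add: y_def)
      have "2 * x1 \<le> 2 ^ Suc j * x1" using x1(3) by (intro mult_right_mono) auto
      hence y1: "y \<ge> x1" using False by (simp add: xy)
      have y2: "y \<le> 2 ^ Suc j * x1" using Suc.prems by (simp add: xy mult_ac)
      have "W x \<le> W y + C * (y powr p * f y)" using x1(2)[OF y1] xy by simp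
      also have "\<dots> \<le> (K + C) * (y powr p * f y)"
        using Suc.IH[OF y1 y2] by (simp add: algebra_simps)
      also have "\<dots> \<le> (K * l) * (y powr p * f y)"
        using KC fp[of y] by (intro mult_right_mono) (auto intro: less_imp_le)
      also have "\<dots> = K * (2 powr p * y powr p) * (2 powr (-\<gamma>) * f y)"
        by (simp add: l_def powr_diff powr_minus divide_inverse)
      also have "\<dots> \<le> K * (2 powr p * y powr p) * f (2 * y)"
        using x1(1)[OF y1] fp[of y] K0
        by (intro mult_left_mono) (auto simp: field_simps)
      also have "\<dots> = K * (x powr p * f x)"
        using y1 x1(3) by (simp add: xy powr_mult)
      finally show ?thesis .
    qed
  qed
  have "eventually (\<lambda>x. norm (W x) \<le> K * norm (x powr p * f x)) at_top"
    using eventually_ge_at_top[of x1]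
  proof eventually_elim
    case (elim x)
    obtain j :: nat where "x / x1 < 2 ^ j" using real_arch_pow[of 2 "x / x1"] by auto
    hence "x \<le> 2 ^ Suc j * x1" using x1(3) elim by (simp add: field_simps)
    thus ?case using main[OF elim] W(2) fp[of x] by simp
  qed
  thus ?thesis by (rule bigoI)
qed

text \<open>The dyadic bound for the constant function 1 (with \<open>C = 0\<close>) is a lower
  Potter bound: 1 is O(x^p f(x)) for every p > \<beta>. Taking p strictly below r leaves the factor
  x^(p - r), which tends to 0.\<close>

lemma powr_smallo_rv_tail:
  assumes f: "rv_tail \<beta> f" and r: "\<beta> < r"
  shows "(\<lambda>x. x powr (- r)) \<in> o[at_top](f)"
proof -
  define p where "p = (\<beta> + r) / 2"
  have p: "\<beta> < p" "p < r" using r by (auto simp: p_def)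
  have 1: "(\<lambda>x. 1) \<in> O[at_top](\<lambda>x. x powr p * f x)"
    by (rule rv_tail_dyadic_bound[OF f p(1), where C = 0]) (auto simp: mono_def)
  have "((\<lambda>x::real. x powr (p - r)) \<longlongrightarrow> 0) at_top"
    using p by (intro tendsto_neg_powr filterlim_ident) auto
  hence 2: "(\<lambda>x::real. x powr (p - r)) \<in> o[at_top](\<lambda>_. 1)"
    by (intro smalloI_tendsto) auto
  have "(\<lambda>x. x powr (p - r) * x powr (- p)) \<in> o[at_top](\<lambda>x. (x powr p * f x) * x powr (- p))"
    using landau_o.small_big_trans[OF 2 1] by (rule landau_o.small.mult_right)
  moreover have "eventually (\<lambda>x. x powr (p - r) * x powr (- p) = x powr (- r)) at_top"
    "eventually (\<lambda>x. (x powr p * f x) * x powr (- p) = f x) at_top"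
    using eventually_gt_at_top[of 0] by (eventually_elim; simp flip: powr_add add: mult_ac; simp add: powr_minus field_simps)+
  ultimately show ?thesis by (rule landau_o.small.cong_ex[THEN iffD1, rotated 2])
qed

section \<open>Moments of centred sums\<close>

lemma powr_one_plus_le:
  fixes r t :: real
  assumes r: "r > 1" and t: "\<bar>t\<bar> \<le> 1/2"
  shows "(1 + t) powr r \<le> 1 + r * t + r * (r - 1) * 2 powr r * t\<^sup>2"
proof -
  \<comment> \<open>two mean value steps replace a second-order Taylor expansion\<close>
  have mv: "\<exists>u. \<bar>u - 1\<bar> \<le> \<bar>t\<bar> \<and> (1 + t) powr s - 1 = t * (s * u powr (s - 1))" if t: "\<bar>t\<bar> \<le> 1/2" for s t :: real
  proof (cases t "0::real" rule: linorder_cases)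
    case less
    have "\<exists>z>1 + t. z < 1 \<and> 1 powr s - (1 + t) powr s = (1 - (1 + t)) * (s * z powr (s - 1))"
      using less t by (intro MVT2 has_real_derivative_powr) auto
    then obtain z where "1 + t < z" "z < 1" "1 powr s - (1 + t) powr s = (1 - (1 + t)) * (s * z powr (s - 1))"
      by blast
    thus ?thesis using less by (intro exI[of _ z]) (auto simp: abs_if algebra_simps)
  next
    case equal thus ?thesis by (intro exI[of _ 1]) auto
  next
    case greater
    have "\<exists>z>1. z < 1 + t \<and> (1 + t) powr s - 1 powr s = ((1 + t) - 1) * (s * z powr (s - 1))"
      using greater t by (intro MVT2 has_real_derivative_powr) auto
    then obtain z where "1 < z" "z < 1 + t" "(1 + t) powr s - 1 powr s = ((1 + t) - 1) * (s * z powr (s - 1))"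
      by blast
    thus ?thesis using greater by (intro exI[of _ z]) (auto simp: abs_if algebra_simps)
  qed
  obtain u where u: "\<bar>u - 1\<bar> \<le> \<bar>t\<bar>" "(1 + t) powr r - 1 = t * (r * u powr (r - 1))"
    using mv[OF t] by blast
  obtain v where v: "\<bar>v - 1\<bar> \<le> \<bar>u - 1\<bar>" "u powr (r - 1) - 1 = (u - 1) * ((r - 1) * v powr (r - 2))"
    using mv[of "u - 1" "r - 1"] u t by (auto simp: algebra_simps)
  have v12: "1/2 \<le> v" "v \<le> 2" using u(1) v(1) t by (auto simp: abs_le_iff)
  \<comment> \<open>The sign of \<open>r - 2\<close> decides at which end of the interval from 1/2
    to 2 the power is largest; \<open>2 powr r\<close> dominates both values because r > 1.\<close>
  have vle: "v powr (r - 2) \<le> 2 powr r"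
  proof (cases "r \<ge> 2")
    case True
    have "v powr (r - 2) \<le> 2 powr (r - 2)" using True v12 by (intro powr_mono2) auto
    also have "\<dots> \<le> 2 powr r" by (intro powr_mono) auto
    finally show ?thesis .
  next
    case False
    have "v powr (r - 2) \<le> (1/2) powr (r - 2)" using False v12 by (intro powr_mono2') auto
    also have "\<dots> = 2 powr (2 - r)" using powr_minus_divide[of 2 "r - 2"] by (simp add: powr_divide)
    also have "\<dots> \<le> 2 powr r" using r by (intro powr_mono) auto
    finally show ?thesis .
  qed
  have "(1 + t) powr r - 1 - r * t = r * (t * (u powr (r - 1) - 1))"
    using u(2) by (simp add: algebra_simps)
  also have "\<dots> = r * (r - 1) * ((t * (u - 1)) * v powr (r - 2))" by (simp add: v(2))
  also have "\<dots> \<le> r * (r - 1) * (t\<^sup>2 * 2 powr r)"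
  proof (intro mult_left_mono)
    have "t * (u - 1) \<le> \<bar>t\<bar> * \<bar>u - 1\<bar>" by (metis abs_ge_self abs_mult)
    also have "\<dots> \<le> \<bar>t\<bar> * \<bar>t\<bar>" using u(1) by (intro mult_left_mono) auto
    finally have "t * (u - 1) \<le> t\<^sup>2" by (simp add: power2_eq_square)
    thus "t * (u - 1) * v powr (r - 2) \<le> t\<^sup>2 * 2 powr r"
      using vle by (intro mult_mono) auto
  qed (use r in auto)
  finally show ?thesis by (simp add: algebra_simps)
qed

text \<open>The linear term is kept exact since it averages to zero when b is centred and
  independent of a. The remainder uses order \<open>min r 2\<close> because for r < 2 a quadratic
  remainder would carry |a|^(r - 2), which is singular at a = 0. By homogeneity everything reduces
  to a = 1 and t = b / a: a second-order expansion for |t| <= 1/2, and otherwise every term is at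
  most a constant times |t|^r.\<close>

lemma abs_powr_add_le:
  fixes r :: real
  assumes r: "r > 1"
  shows "\<exists>C\<ge>0. \<forall>a b::real. \<bar>a + b\<bar> powr r \<le> \<bar>a\<bar> powr r + r * (sgn a * \<bar>a\<bar> powr (r - 1)) * b
           + C * (\<bar>a\<bar> powr (r - min r 2) * \<bar>b\<bar> powr (min r 2) + \<bar>b\<bar> powr r)"
proof -
  define q where "q = min r 2"
  \<comment> \<open>The last summand serves |t| <= 1/2. The first two serve |t| > 1/2, where |1 + t|
    <= 3 |t| and |t| <= |t| (2 |t|)^(r - 1). Moreover \<open>1 \<le> C\<close> settles the case a =
    0.\<close>
  define C where "C = 3 powr r + r * 2 powr (r - 1) + r * (r - 1) * 2 powr r"
  have C: "r * (r - 1) * 2 powr r \<le> C" "3 powr r + r * 2 powr (r - 1) \<le> C" "1 \<le> C"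
    using r by (auto simp: C_def intro!: add_increasing2 ge_one_powr_ge_zero)
  have q: "0 < q" "q \<le> 2" "q \<le> r" using r by (auto simp: q_def)
  have one: "\<bar>1 + t\<bar> powr r \<le> 1 + r * t + C * (\<bar>t\<bar> powr q + \<bar>t\<bar> powr r)" for t :: real
  proof (cases "\<bar>t\<bar> \<le> 1/2")
    case True
    have "\<bar>1 + t\<bar> powr r \<le> 1 + r * t + r * (r - 1) * 2 powr r * t\<^sup>2"
      using powr_one_plus_le[OF r True] True by (auto simp: abs_le_iff)
    also have "r * (r - 1) * 2 powr r * t\<^sup>2 \<le> C * (\<bar>t\<bar> powr q + \<bar>t\<bar> powr r)"
    proof (rule mult_mono)
      have "t\<^sup>2 = \<bar>t\<bar> powr 2" by (cases "t = 0") auto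
      also have "\<dots> \<le> \<bar>t\<bar> powr q" using True q by (intro powr_mono') auto
      finally show "t\<^sup>2 \<le> \<bar>t\<bar> powr q + \<bar>t\<bar> powr r" by (simp add: add_increasing2)
    qed (use C in auto)
    finally show ?thesis by simp
  next
    case False
    have "\<bar>1 + t\<bar> powr r \<le> (3 * \<bar>t\<bar>) powr r"
      using False r by (intro powr_mono2) auto
    also have "\<dots> = 3 powr r * \<bar>t\<bar> powr r" by (simp add: powr_mult)
    finally have 1: "\<bar>1 + t\<bar> powr r \<le> 3 powr r * \<bar>t\<bar> powr r" .
    have "1 \<le> (2 * \<bar>t\<bar>) powr (r - 1)" using False r by (intro ge_one_powr_ge_zero) auto
    hence "\<bar>t\<bar> * 1 \<le> \<bar>t\<bar> * (2 * \<bar>t\<bar>) powr (r - 1)" by (intro mult_left_mono) auto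
    also have "\<dots> = 2 powr (r - 1) * \<bar>t\<bar> powr r" by (simp add: powr_mult powr_mult_base)
    finally have "r * \<bar>t\<bar> \<le> r * (2 powr (r - 1) * \<bar>t\<bar> powr r)" using r by (intro mult_left_mono) auto
    moreover have "- (r * t) \<le> r * \<bar>t\<bar>"
      using r by (metis abs_ge_minus_self abs_mult abs_of_pos less_trans zero_less_one)
    ultimately have "\<bar>1 + t\<bar> powr r \<le> r * t + (3 powr r + r * 2 powr (r - 1)) * \<bar>t\<bar> powr r"
      using 1 by (simp add: algebra_simps)
    also have "(3 powr r + r * 2 powr (r - 1)) * \<bar>t\<bar> powr r \<le> C * (\<bar>t\<bar> powr q + \<bar>t\<bar> powr r)"
      using C by (intro mult_mono) auto
    finally show ?thesis by simp
  qed
  have "\<bar>a + b\<bar> powr r \<le> \<bar>a\<bar> powr r + r * (sgn a * \<bar>a\<bar> powr (r - 1)) * b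
           + C * (\<bar>a\<bar> powr (r - q) * \<bar>b\<bar> powr q + \<bar>b\<bar> powr r)" for a b :: real
  proof (cases "a = 0")
    case True
    have "1 * \<bar>b\<bar> powr r \<le> C * \<bar>b\<bar> powr r" using C by (intro mult_right_mono) auto
    thus ?thesis using True by simp
  next
    case False
    define t where "t = b / a"
    have b: "b = a * t" using False by (simp add: t_def)
    have ar: "\<bar>a\<bar> powr (r - 1) * \<bar>a\<bar> = \<bar>a\<bar> powr r"
      using False by (simp add: powr_diff)
    have "\<bar>a + b\<bar> powr r = \<bar>a\<bar> powr r * \<bar>1 + t\<bar> powr r"
      by (simp add: b flip: powr_mult abs_mult) (simp add: algebra_simps)
    also have "\<dots> \<le> \<bar>a\<bar> powr r * (1 + r * t + C * (\<bar>t\<bar> powr q + \<bar>t\<bar> powr r))"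
      by (intro mult_left_mono one) auto
    also have "\<dots> = \<bar>a\<bar> powr r + r * (\<bar>a\<bar> powr r * t) + C * (\<bar>a\<bar> powr r * \<bar>t\<bar> powr q + \<bar>a\<bar> powr r * \<bar>t\<bar> powr r)"
      by (simp add: algebra_simps)
    also have "\<bar>a\<bar> powr r * t = sgn a * \<bar>a\<bar> powr (r - 1) * b"
      by (simp add: b flip: ar abs_sgn) (simp add: abs_sgn mult_ac)
    also have "\<bar>a\<bar> powr r * \<bar>t\<bar> powr q = \<bar>a\<bar> powr (r - q) * \<bar>b\<bar> powr q"
      using False by (simp add: b abs_mult powr_mult powr_diff)
    also have "\<bar>a\<bar> powr r * \<bar>t\<bar> powr r = \<bar>b\<bar> powr r"
      by (simp add: b abs_mult powr_mult)
    finally show ?thesis by (simp add: mult_ac)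
  qed
  thus ?thesis using C(3) unfolding q_def by (intro exI[of _ C]) auto
qed

lemma (in finite_measure) integrable_powr_mono:
  fixes X :: "'a \<Rightarrow> real"
  assumes "integrable M (\<lambda>\<omega>. \<bar>X \<omega>\<bar> powr r)" "X \<in> borel_measurable M" "0 \<le> s" "s \<le> r"
  shows "integrable M (\<lambda>\<omega>. \<bar>X \<omega>\<bar> powr s)"
proof (rule Bochner_Integration.integrable_bound)
  show "integrable M (\<lambda>\<omega>. 1 + \<bar>X \<omega>\<bar> powr r)" using assms by auto
  have "\<bar>x\<bar> powr s \<le> 1 + \<bar>x\<bar> powr r" for x :: real
  proof (cases "\<bar>x\<bar> \<le> 1")
    case True
    hence "\<bar>x\<bar> powr s \<le> 1" using assms by (intro powr_le1) auto
    thus ?thesis by (simp add: add_increasing2)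
  next
    case False
    hence "\<bar>x\<bar> powr s \<le> \<bar>x\<bar> powr r" using assms by (intro powr_mono) auto
    thus ?thesis by simp
  qed
  thus "AE x in M. norm (\<bar>X x\<bar> powr s) \<le> norm (1 + \<bar>X x\<bar> powr r)" by auto
qed (use assms in measurable)

text \<open>The endpoint 0 has to be included because summands may vanish; there convexity amounts
  to c^r <= c for 0 < c < 1.\<close>

lemma convex_on_powr_nonneg:
  assumes r: "r \<ge> 1"
  shows "convex_on {0..} (\<lambda>x::real. x powr r)"
proof (rule convex_onI)
  fix t x y :: real
  assume t: "0 < t" "t < 1" and xy: "x \<in> {0..}" "y \<in> {0..}"
  have z: "(c * u) powr r \<le> c * u powr r" if "0 < c" "c < 1" for c u :: real
  proof -
    have "c powr r \<le> c powr 1" using that r by (intro powr_mono') auto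
    thus ?thesis using that by (simp add: powr_mult mult_right_mono)
  qed
  show "((1 - t) *\<^sub>R x + t *\<^sub>R y) powr r \<le> (1 - t) * x powr r + t * y powr r"
  proof (cases "x = 0 \<or> y = 0")
    case True
    thus ?thesis using z[of t y] z[of "1 - t" x] t by auto
  next
    case False
    thus ?thesis using convex_onD[OF powr_convex[OF r], of t x y] t xy by auto
  qed
qed auto

text \<open>Jensen's inequality for the uniform average of the |x_i|.\<close>

lemma abs_sum_powr_le:
  fixes x :: "nat \<Rightarrow> real"
  assumes "r \<ge> 1" "k \<ge> 1"
  shows "\<bar>\<Sum>i=1..k. x i\<bar> powr r \<le> real k powr (r - 1) * (\<Sum>i=1..k. \<bar>x i\<bar> powr r)"
proof -
  have cv: "convex_on {0..} (\<lambda>x::real. x powr r)"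
    using assms by (intro convex_on_powr_nonneg) auto
  have "(\<Sum>i=1..k. (1 / k) *\<^sub>R \<bar>x i\<bar>) powr r \<le> (\<Sum>i=1..k. (1 / k) * \<bar>x i\<bar> powr r)"
    using assms by (intro convex_on_sum[OF _ _ cv]) auto
  hence "(\<Sum>i=1..k. \<bar>x i\<bar>) powr r / real k powr r \<le> (\<Sum>i=1..k. \<bar>x i\<bar> powr r) / real k"
    by (simp flip: sum_divide_distrib add: powr_divide sum_nonneg)
  hence "(\<Sum>i=1..k. \<bar>x i\<bar>) powr r \<le> real k powr (r - 1) * (\<Sum>i=1..k. \<bar>x i\<bar> powr r)"
    using assms by (simp add: field_simps powr_diff)
  moreover have "\<bar>\<Sum>i=1..k. x i\<bar> powr r \<le> (\<Sum>i=1..k. \<bar>x i\<bar>) powr r"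
    using assms by (intro powr_mono2 sum_abs) auto
  ultimately show ?thesis by simp
qed

text \<open>Expand |S_k + Z_(k+1)|^r with \<open>abs_powr_add_le\<close>. The linear term has mean
  zero by independence and centring, so one step adds at most C (E|S_k|^s E|Z|^q + E|Z|^r), where q
  = min r 2 and s = r - q. A crude bound gives E|S_k|^s = O(k^s), and summing k such increments
  gives k^(s + 1). For r <= 2 this is linear growth, as in the von Bahr-Esseen inequality.\<close>

lemma (in prob_space) centered_sum_moment_le:
  fixes Z :: "nat \<Rightarrow> 'a \<Rightarrow> real"
  assumes indep: "indep_vars (\<lambda>_. borel) Z {1..}"
    and id: "\<And>i. 1 \<le> i \<Longrightarrow> distr M borel (Z i) = distr M borel (Z 1)"
    and r: "r > 1" and int: "integrable M (\<lambda>\<omega>. \<bar>Z 1 \<omega>\<bar> powr r)"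
    and mean: "expectation (Z 1) = 0"
  shows "\<exists>C\<ge>0. \<forall>k. integrable M (\<lambda>\<omega>. \<bar>\<Sum>i=1..k. Z i \<omega>\<bar> powr r) \<and>
           expectation (\<lambda>\<omega>. \<bar>\<Sum>i=1..k. Z i \<omega>\<bar> powr r) \<le> C * real k powr (r - min r 2 + 1)"
proof -
  define q where "q = min r 2"
  define s where "s = r - q"
  have q: "1 < q" "q \<le> r" and s: "0 \<le> s" using r by (auto simp: q_def s_def)
  have rv [measurable]: "Z i \<in> borel_measurable M" if "1 \<le> i" for i
    using indep that by (auto simp: indep_vars_def)
  have transfer: "integrable M (\<lambda>\<omega>. h (Z i \<omega>)) = integrable M (\<lambda>\<omega>. h (Z 1 \<omega>))"
    "expectation (\<lambda>\<omega>. h (Z i \<omega>)) = expectation (\<lambda>\<omega>. h (Z 1 \<omega>))"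
    if "1 \<le> i" and [measurable]: "h \<in> borel_measurable borel" for i and h :: "real \<Rightarrow> real"
  proof -
    note [measurable] = rv[OF that(1)] rv[of 1, simplified]
    show "integrable M (\<lambda>\<omega>. h (Z i \<omega>)) = integrable M (\<lambda>\<omega>. h (Z 1 \<omega>))"
      using integrable_distr_eq[of "Z i" M borel h] integrable_distr_eq[of "Z 1" M borel h] id[OF that(1)]
      by simp
    show "expectation (\<lambda>\<omega>. h (Z i \<omega>)) = expectation (\<lambda>\<omega>. h (Z 1 \<omega>))"
      using integral_distr[of "Z i" M borel h] integral_distr[of "Z 1" M borel h] id[OF that(1)]
      by simp
  qed
  have int_pow: "integrable M (\<lambda>\<omega>. \<bar>Z i \<omega>\<bar> powr t)" if "1 \<le> i" "0 \<le> t" "t \<le> r" for i t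
    by (subst transfer(1)[OF that(1), of "\<lambda>x. \<bar>x\<bar> powr t"])
       (use that integrable_powr_mono[OF int rv] in auto)
  have int_Z: "integrable M (Z i)" if "1 \<le> i" for i
    by (rule Bochner_Integration.integrable_bound[OF int_pow[OF that, of 1]])
       (use r that rv in auto)
  have mean_Z: "expectation (Z i) = 0" if "1 \<le> i" for i
    using transfer(2)[OF that, of "\<lambda>x. x"] mean by simp
  define c where "c = expectation (\<lambda>\<omega>. \<bar>Z 1 \<omega>\<bar> powr r)"
  define cq where "cq = expectation (\<lambda>\<omega>. \<bar>Z 1 \<omega>\<bar> powr q)"
  have c_eq: "expectation (\<lambda>\<omega>. \<bar>Z i \<omega>\<bar> powr r) = c"
    and cq_eq: "expectation (\<lambda>\<omega>. \<bar>Z i \<omega>\<bar> powr q) = cq" if "1 \<le> i" for i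
    unfolding c_def cq_def by (rule transfer(2)[OF that]; measurable)+
  have c: "0 \<le> c" "0 \<le> cq" by (auto simp: c_def cq_def)
  define S where "S k \<omega> = (\<Sum>i=1..k. Z i \<omega>)" for k \<omega>
  have [measurable]: "S k \<in> borel_measurable M" for k
    unfolding S_def by (intro borel_measurable_sum rv) auto
  \<comment> \<open>This bound ignores cancellation. It provides integrability and, through its
    order k^r, the estimate of E|S_k|^s below.\<close>
  have int_S: "integrable M (\<lambda>\<omega>. \<bar>S k \<omega>\<bar> powr r)"
    and crude: "expectation (\<lambda>\<omega>. \<bar>S k \<omega>\<bar> powr r) \<le> real k powr r * c" for k
  proof -
    show i: "integrable M (\<lambda>\<omega>. \<bar>S k \<omega>\<bar> powr r)"
    proof (cases "k = 0")
      case False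
      show ?thesis
      proof (rule Bochner_Integration.integrable_bound)
        show "integrable M (\<lambda>\<omega>. real k powr (r - 1) * (\<Sum>i=1..k. \<bar>Z i \<omega>\<bar> powr r))"
          using r by (intro integrable_mult_right Bochner_Integration.integrable_sum int_pow) auto
        show "AE \<omega> in M. norm (\<bar>S k \<omega>\<bar> powr r) \<le> norm (real k powr (r - 1) * (\<Sum>i=1..k. \<bar>Z i \<omega>\<bar> powr r))"
          using abs_sum_powr_le[of r k] False r unfolding S_def by (auto intro!: AE_I2 simp: sum_nonneg)
      qed measurable
    qed (auto simp: S_def)
    show "expectation (\<lambda>\<omega>. \<bar>S k \<omega>\<bar> powr r) \<le> real k powr r * c"
    proof (cases "k = 0")
      case False
      have "expectation (\<lambda>\<omega>. \<bar>S k \<omega>\<bar> powr r)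
              \<le> expectation (\<lambda>\<omega>. real k powr (r - 1) * (\<Sum>i=1..k. \<bar>Z i \<omega>\<bar> powr r))"
        using r False abs_sum_powr_le[of r k] unfolding S_def
        by (intro integral_mono i[unfolded S_def] integrable_mult_right Bochner_Integration.integrable_sum int_pow) auto
      also have "\<dots> = real k powr (r - 1) * (\<Sum>i=1..k. expectation (\<lambda>\<omega>. \<bar>Z i \<omega>\<bar> powr r))"
        using r by (simp add: int_pow)
      also have "(\<Sum>i=1..k. expectation (\<lambda>\<omega>. \<bar>Z i \<omega>\<bar> powr r)) = (\<Sum>i=1..k. c)"
        by (intro sum.cong refl c_eq) auto
      also have "real k powr (r - 1) * (\<Sum>i=1..k. c) = real k powr r * c"
        using False by (simp add: powr_diff)
      finally show ?thesis .
    qed (auto simp: S_def)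
  qed
  have int_Ss: "integrable M (\<lambda>\<omega>. \<bar>S k \<omega>\<bar> powr t)" if "0 \<le> t" "t \<le> r" for k t
    by (rule integrable_powr_mono[OF int_S _ that]) measurable
  \<comment> \<open>Interpolation between the orders 0 and r after scaling by k. The factor uses
    \<open>Suc k\<close> because the increment at k = 0 must also be covered, whereas
    \<open>real 0 powr s\<close> is 0.\<close>
  have ES: "expectation (\<lambda>\<omega>. \<bar>S k \<omega>\<bar> powr s) \<le> real (Suc k) powr s * (1 + c)" for k
  proof (cases "k = 0")
    case False
    have pw: "\<bar>x\<bar> powr s \<le> real k powr s * (1 + \<bar>x\<bar> powr r / real k powr r)" for x :: real
    proof -
      have "(\<bar>x\<bar> / k) powr s \<le> 1 + (\<bar>x\<bar> / k) powr r"
      proof (cases "\<bar>x\<bar> / k \<le> 1")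
        case True
        hence "(\<bar>x\<bar> / k) powr s \<le> 1" using s by (intro powr_le1) auto
        thus ?thesis by (simp add: add_increasing2)
      next
        case False
        hence "(\<bar>x\<bar> / k) powr s \<le> (\<bar>x\<bar> / k) powr r" using q by (intro powr_mono) (auto simp: s_def)
        thus ?thesis by simp
      qed
      thus ?thesis using False by (simp add: powr_divide field_simps)
    qed
    have "expectation (\<lambda>\<omega>. \<bar>S k \<omega>\<bar> powr s)
            \<le> expectation (\<lambda>\<omega>. real k powr s * (1 + \<bar>S k \<omega>\<bar> powr r / real k powr r))"
      using q s by (intro integral_mono pw int_Ss) (auto simp: s_def int_S)
    also have "\<dots> = real k powr s * (1 + expectation (\<lambda>\<omega>. \<bar>S k \<omega>\<bar> powr r) / real k powr r)"
      using int_S by (simp add: prob_space)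
    also have "\<dots> \<le> real (Suc k) powr s * (1 + c)"
      using crude[of k] False s by (intro mult_mono powr_mono2) (auto simp: field_simps)
    finally show ?thesis .
  qed (use c in \<open>auto simp: S_def\<close>)
  obtain C where C: "C \<ge> 0" "\<And>a b::real. \<bar>a + b\<bar> powr r \<le> \<bar>a\<bar> powr r + r * (sgn a * \<bar>a\<bar> powr (r - 1)) * b
           + C * (\<bar>a\<bar> powr s * \<bar>b\<bar> powr q + \<bar>b\<bar> powr r)"
    using abs_powr_add_le[OF r] unfolding q_def s_def by blast
  define D where "D = C * ((1 + c) * cq + c)"
  have D: "D \<ge> 0" using C c by (auto simp: D_def)
  have step: "expectation (\<lambda>\<omega>. \<bar>S (Suc k) \<omega>\<bar> powr r)
      \<le> expectation (\<lambda>\<omega>. \<bar>S k \<omega>\<bar> powr r) + D * real (Suc k) powr s" for k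
  proof -
    let ?Z = "Z (Suc k)"
    have ind: "indep_var borel ?Z borel (S k)"
      unfolding S_def by (rule indep_vars_sum) (auto intro: indep_vars_subset[OF indep])
    have ind1: "indep_var borel ?Z borel (\<lambda>\<omega>. sgn (S k \<omega>) * \<bar>S k \<omega>\<bar> powr (r - 1))"
      using indep_var_compose[OF ind, of "\<lambda>x. x" borel "\<lambda>x. sgn x * \<bar>x\<bar> powr (r - 1)" borel]
      by (simp add: comp_def)
    have ind2: "indep_var borel (\<lambda>\<omega>. \<bar>?Z \<omega>\<bar> powr q) borel (\<lambda>\<omega>. \<bar>S k \<omega>\<bar> powr s)"
      using indep_var_compose[OF ind, of "\<lambda>x. \<bar>x\<bar> powr q" borel "\<lambda>x. \<bar>x\<bar> powr s" borel]
      by (simp add: comp_def)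
    have i1: "integrable M (\<lambda>\<omega>. sgn (S k \<omega>) * \<bar>S k \<omega>\<bar> powr (r - 1))"
    proof (rule Bochner_Integration.integrable_bound)
      show "integrable M (\<lambda>\<omega>. \<bar>S k \<omega>\<bar> powr (r - 1))" using r by (intro int_Ss) auto
      show "AE \<omega> in M. norm (sgn (S k \<omega>) * \<bar>S k \<omega>\<bar> powr (r - 1)) \<le> norm (\<bar>S k \<omega>\<bar> powr (r - 1))"
        by (intro AE_I2) (auto simp: abs_mult sgn_if)
    qed measurable
    have i2: "integrable M (\<lambda>\<omega>. \<bar>S k \<omega>\<bar> powr s)" "integrable M (\<lambda>\<omega>. \<bar>?Z \<omega>\<bar> powr q)"
      "integrable M (\<lambda>\<omega>. \<bar>?Z \<omega>\<bar> powr r)" "integrable M ?Z"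
      using q s r by (auto intro!: int_Ss int_pow int_Z simp: s_def)
    have p1: "integrable M (\<lambda>\<omega>. sgn (S k \<omega>) * \<bar>S k \<omega>\<bar> powr (r - 1) * ?Z \<omega>)"
      "expectation (\<lambda>\<omega>. sgn (S k \<omega>) * \<bar>S k \<omega>\<bar> powr (r - 1) * ?Z \<omega>) = 0"
      using indep_var_integrable[OF ind1 i2(4) i1] indep_var_lebesgue_integral[OF ind1 i2(4) i1] mean_Z[of "Suc k"]
      by (simp_all add: mult_ac)
    have p2: "integrable M (\<lambda>\<omega>. \<bar>S k \<omega>\<bar> powr s * \<bar>?Z \<omega>\<bar> powr q)"
      "expectation (\<lambda>\<omega>. \<bar>S k \<omega>\<bar> powr s * \<bar>?Z \<omega>\<bar> powr q) = expectation (\<lambda>\<omega>. \<bar>S k \<omega>\<bar> powr s) * cq"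
      using indep_var_integrable[OF ind2 i2(2,1)] indep_var_lebesgue_integral[OF ind2 i2(2,1)] cq_eq[of "Suc k"]
      by (simp_all add: mult_ac)
    have "S (Suc k) \<omega> = S k \<omega> + ?Z \<omega>" for \<omega> by (simp add: S_def)
    hence "expectation (\<lambda>\<omega>. \<bar>S (Suc k) \<omega>\<bar> powr r) = expectation (\<lambda>\<omega>. \<bar>S k \<omega> + ?Z \<omega>\<bar> powr r)" by simp
    also have "\<dots> \<le> expectation (\<lambda>\<omega>. \<bar>S k \<omega>\<bar> powr r + r * (sgn (S k \<omega>) * \<bar>S k \<omega>\<bar> powr (r - 1) * ?Z \<omega>)
           + C * (\<bar>S k \<omega>\<bar> powr s * \<bar>?Z \<omega>\<bar> powr q + \<bar>?Z \<omega>\<bar> powr r))"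
    proof (rule integral_mono)
      show "integrable M (\<lambda>\<omega>. \<bar>S k \<omega> + ?Z \<omega>\<bar> powr r)" using int_S[of "Suc k"] by (simp add: S_def)
    qed (use C(2) p1 p2 i2 int_S in \<open>auto simp: mult.assoc\<close>)
    also have "\<dots> = expectation (\<lambda>\<omega>. \<bar>S k \<omega>\<bar> powr r) + C * (expectation (\<lambda>\<omega>. \<bar>S k \<omega>\<bar> powr s) * cq + c)"
      using p1 p2 i2 int_S c_eq[of "Suc k"] by simp
    also have "C * (expectation (\<lambda>\<omega>. \<bar>S k \<omega>\<bar> powr s) * cq + c) \<le> D * real (Suc k) powr s"
    proof -
      have "c * 1 \<le> c * real (Suc k) powr s" using c s by (intro mult_left_mono ge_one_powr_ge_zero) auto
      moreover have "expectation (\<lambda>\<omega>. \<bar>S k \<omega>\<bar> powr s) * cq \<le> real (Suc k) powr s * (1 + c) * cq"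
        using ES c by (intro mult_right_mono) auto
      ultimately have "expectation (\<lambda>\<omega>. \<bar>S k \<omega>\<bar> powr s) * cq + c \<le> ((1 + c) * cq + c) * real (Suc k) powr s"
        by (simp add: algebra_simps)
      thus ?thesis unfolding D_def mult.assoc using C(1) by (intro mult_left_mono)
    qed
    finally show ?thesis by simp
  qed
  have "expectation (\<lambda>\<omega>. \<bar>S k \<omega>\<bar> powr r) \<le> D * (real k * real k powr s)" for k
  proof (induction k)
    case 0 thus ?case by (simp add: S_def)
  next
    case (Suc k)
    have "D * (real k * real k powr s) \<le> D * (real k * real (Suc k) powr s)"
      using D s by (intro mult_left_mono powr_mono2) auto
    with step[of k] Suc show ?case by (simp add: algebra_simps)
  qed
  thus ?thesis
    using D int_S unfolding S_def s_def q_def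
    by (intro exI[of _ D]) (simp add: powr_mult_base add.commute)
qed

lemma (in prob_space) centered_sum_tail_le:
  fixes Z :: "nat \<Rightarrow> 'a \<Rightarrow> real"
  assumes indep: "indep_vars (\<lambda>_. borel) Z {1..}"
    and id: "\<And>i. 1 \<le> i \<Longrightarrow> distr M borel (Z i) = distr M borel (Z 1)"
    and r: "r > 1" and int: "integrable M (\<lambda>\<omega>. \<bar>Z 1 \<omega>\<bar> powr r)"
    and mean: "expectation (Z 1) = 0"
  shows "\<exists>C\<ge>0. \<forall>k. \<forall>y>0. prob {\<omega>\<in>space M. \<bar>\<Sum>i=1..k. Z i \<omega>\<bar> > y}
           \<le> C * real k powr (r - min r 2 + 1) * y powr (- r)"
proof -
  obtain C where C: "C \<ge> 0" "\<And>k. integrable M (\<lambda>\<omega>. \<bar>\<Sum>i=1..k. Z i \<omega>\<bar> powr r)"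
    "\<And>k. expectation (\<lambda>\<omega>. \<bar>\<Sum>i=1..k. Z i \<omega>\<bar> powr r) \<le> C * real k powr (r - min r 2 + 1)"
    using centered_sum_moment_le[OF assms] by blast
  have "prob {\<omega>\<in>space M. \<bar>\<Sum>i=1..k. Z i \<omega>\<bar> > y} \<le> C * real k powr (r - min r 2 + 1) * y powr (- r)"
    if y: "y > 0" for k y
  proof -
    have "Z i \<in> borel_measurable M" if "1 \<le> i" for i
      using indep that by (auto simp: indep_vars_def)
    hence [measurable]: "(\<lambda>\<omega>. \<Sum>i=1..k. Z i \<omega>) \<in> borel_measurable M" by (intro borel_measurable_sum) auto
    have "prob {\<omega>\<in>space M. \<bar>\<Sum>i=1..k. Z i \<omega>\<bar> > y} \<le> prob {\<omega>\<in>space M. \<bar>\<Sum>i=1..k. Z i \<omega>\<bar> powr r \<ge> y powr r}"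
    proof (rule finite_measure_mono)
      show "{\<omega>\<in>space M. \<bar>\<Sum>i=1..k. Z i \<omega>\<bar> > y} \<subseteq> {\<omega>\<in>space M. \<bar>\<Sum>i=1..k. Z i \<omega>\<bar> powr r \<ge> y powr r}"
        using y r by (intro Collect_mono conj_mono imp_refl impI powr_mono2) (auto simp only: less_imp_le)
    qed measurable
    also have "\<dots> \<le> expectation (\<lambda>\<omega>. \<bar>\<Sum>i=1..k. Z i \<omega>\<bar> powr r) / (y powr r)"
      by (rule integral_Markov_inequality_measure[OF C(2), where A = "{}"]) (use y in simp_all)
    also have "\<dots> \<le> C * real k powr (r - min r 2 + 1) / (y powr r)"
      by (rule divide_right_mono[OF C(3)]) simp
    finally show ?thesis by (simp only: powr_minus divide_inverse)
  qed
  with C(1) show ?thesis by (intro exI[of _ C] conjI allI impI)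
qed

section \<open>Random sums\<close>

text \<open>This is the Karamata-type estimate obtained from the dyadic bound: raising the
  truncation level from x to 2 x adds at most (2 x)^p on the event N > x. The \<open>max 0 x\<close>
  makes the truncated moment monotone on the whole real line.\<close>

lemma (in prob_space) truncated_moment_bigo:
  fixes N :: "'a \<Rightarrow> nat"
  assumes N [measurable]: "N \<in> measurable M (count_space UNIV)"
    and f: "rv_tail \<beta> f" and p: "\<beta> < p"
    and tail: "(\<lambda>x. prob {\<omega>\<in>space M. real (N \<omega>) > x}) \<in> O[at_top](f)"
  shows "(\<lambda>x. expectation (\<lambda>\<omega>. min (real (N \<omega>)) (max 0 x) powr p)) \<in> O[at_top](\<lambda>x. x powr p * f x)"
proof -
  have p0: "p > 0" using p rv_tailD(1)[OF f] by simp
  have int: "integrable M (\<lambda>\<omega>. min (real (N \<omega>)) (max 0 x) powr p)" for x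
    using p0 by (intro integrable_const_bound[where B = "max 0 x powr p"]) (auto intro!: powr_mono2)
  obtain C where C: "eventually (\<lambda>x. norm (prob {\<omega>\<in>space M. real (N \<omega>) > x}) \<le> C * norm (f x)) at_top"
    using tail by (elim landau_o.bigE)
  show ?thesis
  proof (rule rv_tail_dyadic_bound[OF f p, where C = "2 powr p * C"])
    show "mono (\<lambda>x. expectation (\<lambda>\<omega>. min (real (N \<omega>)) (max 0 x) powr p))"
      using p0 by (intro monoI integral_mono int powr_mono2) auto
    show "0 \<le> expectation (\<lambda>\<omega>. min (real (N \<omega>)) (max 0 x) powr p)" for x
      by simp
    show "eventually (\<lambda>x. expectation (\<lambda>\<omega>. min (real (N \<omega>)) (max 0 (2 * x)) powr p)
        \<le> expectation (\<lambda>\<omega>. min (real (N \<omega>)) (max 0 x) powr p) + 2 powr p * C * (x powr p * f x)) at_top"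
      using C eventually_ge_at_top[of 0]
    proof eventually_elim
      case (elim x)
      let ?A = "{\<omega>\<in>space M. real (N \<omega>) > x}"
      have A [measurable]: "?A \<in> sets M" by measurable
      have iA: "integrable M (\<lambda>\<omega>. (2 * x) powr p * indicator ?A \<omega>)"
        using A by (intro integrable_mult_right integrable_real_indicator) (auto simp: less_top[symmetric])
      have "expectation (\<lambda>\<omega>. min (real (N \<omega>)) (max 0 (2 * x)) powr p)
          \<le> expectation (\<lambda>\<omega>. min (real (N \<omega>)) (max 0 x) powr p + (2 * x) powr p * indicator ?A \<omega>)"
      proof (rule integral_mono)
        fix \<omega> assume "\<omega> \<in> space M"
        show "min (real (N \<omega>)) (max 0 (2 * x)) powr p
           \<le> min (real (N \<omega>)) (max 0 x) powr p + (2 * x) powr p * indicator ?A \<omega>"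
        proof (cases "real (N \<omega>) > x")
          case True
          have "min (real (N \<omega>)) (max 0 (2 * x)) powr p \<le> (2 * x) powr p"
            using p0 elim by (intro powr_mono2) auto
          thus ?thesis using True \<open>\<omega> \<in> space M\<close> by (simp add: add_increasing)
        next
          case False
          thus ?thesis using elim by (simp add: min_def)
        qed
      qed (intro int Bochner_Integration.integrable_add iA)+
      also have "\<dots> = expectation (\<lambda>\<omega>. min (real (N \<omega>)) (max 0 x) powr p) + (2 * x) powr p * prob ?A"
        using int iA by simp
      also have "(2 * x) powr p * prob ?A \<le> (2 * x) powr p * (C * f x)"
        using elim rv_tailD(3)[OF f, of x] by (intro mult_left_mono) auto
      also have "\<dots> = 2 powr p * C * (x powr p * f x)" by (simp add: powr_mult)
      finally show ?case by simp
    qed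
  qed
qed

text \<open>For k <= x drop k from x + k. For k > x drop x instead and use that k^(p' - r) decreases
  in k. The second regime is where a threshold growing with the number of terms pays off: however
  large k is, the bound stays at x^(p' - r).\<close>

lemma powr_div_add_powr_le:
  fixes x p p' r :: real and k :: nat
  assumes x: "x > 0" and p: "0 \<le> p" "p \<le> p'" "p' \<le> r"
  shows "real k powr p * (x + real k) powr (- r) \<le> x powr (- r) * min (real k) (max 0 x) powr p'"
proof (cases "k = 0")
  case False
  have kp: "real k powr p \<le> real k powr p'" using False p by (intro powr_mono) auto
  show ?thesis
  proof (cases "real k \<le> x")
    case True
    have "(x + real k) powr (- r) \<le> x powr (- r)" using x p by (intro powr_mono2') auto
    with kp have "real k powr p * (x + real k) powr (- r) \<le> real k powr p' * x powr (- r)"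
      by (intro mult_mono) auto
    thus ?thesis using True x by (simp add: min_def mult.commute)
  next
    case kx: False
    have "(x + real k) powr (- r) \<le> real k powr (- r)" using False x p by (intro powr_mono2') auto
    with kp have "real k powr p * (x + real k) powr (- r) \<le> real k powr p' * real k powr (- r)"
      by (intro mult_mono) auto
    also have "\<dots> = real k powr (p' - r)" using False by (simp flip: powr_add)
    also have "\<dots> \<le> x powr (p' - r)" using kx x p by (intro powr_mono2') auto
    also have "\<dots> = x powr (- r) * x powr p'" using x by (simp flip: powr_add)
    finally show ?thesis using kx x by (simp add: min_def)
  qed
qed (use x in auto)

text \<open>Conditioning on N = k and applying the tail bound for k summands at level \<delta> (x +
  k) gives at most K x^(-r) E min(N, x)^p'. The truncated moment estimate makes this O(x^(p' - r)
  f(x)), which is o(f).\<close>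

lemma (in prob_space) random_sum_deviation:
  fixes N :: "'a \<Rightarrow> nat" and Z :: "nat \<Rightarrow> 'a \<Rightarrow> real"
  assumes indep: "indep_vars (\<lambda>_. borel) Z {1..}"
    and id: "\<And>i. 1 \<le> i \<Longrightarrow> distr M borel (Z i) = distr M borel (Z 1)"
    and r: "r > 1" "\<beta> < r" and int: "integrable M (\<lambda>\<omega>. \<bar>Z 1 \<omega>\<bar> powr r)"
    and mean: "expectation (Z 1) = 0"
    and N [measurable]: "N \<in> measurable M (count_space UNIV)"
    and ind: "\<And>k. indep_var borel (\<lambda>\<omega>. real (N \<omega>)) borel (\<lambda>\<omega>. \<Sum>i=1..k. Z i \<omega>)"
    and f: "rv_tail \<beta> f"
    and tail: "(\<lambda>x. prob {\<omega>\<in>space M. real (N \<omega>) > x}) \<in> O[at_top](f)"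
    and \<delta>: "\<delta> > 0"
  shows "(\<lambda>x. prob {\<omega>\<in>space M. \<bar>\<Sum>i=1..N \<omega>. Z i \<omega>\<bar> > \<delta> * (x + real (N \<omega>))}) \<in> o[at_top](f)"
proof -
  define p where "p = r - min r 2 + 1"
  \<comment> \<open>Strictly above \<beta> for the truncated moment, at least p for the pointwise
    inequality, and strictly below r for the final decay.\<close>
  define p' where "p' = (max \<beta> p + r) / 2"
  have p: "0 \<le> p" "p \<le> p'" "p' < r" "\<beta> < p'" using r by (auto simp: p_def p'_def max_def min_def)
  obtain C where C: "C \<ge> 0" "\<And>k y. y > 0 \<Longrightarrow>
      prob {\<omega>\<in>space M. \<bar>\<Sum>i=1..k. Z i \<omega>\<bar> > y} \<le> C * real k powr p * y powr (- r)"
    using centered_sum_tail_le[OF indep id r(1) int mean] unfolding p_def by blast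
  define K where "K = C * \<delta> powr (- r)"
  define W where "W x = expectation (\<lambda>\<omega>. min (real (N \<omega>)) (max 0 x) powr p')" for x
  have Zm: "Z i \<in> borel_measurable M" if "1 \<le> i" for i
    using indep that by (auto simp: indep_vars_def)
  have Sm [measurable]: "(\<lambda>\<omega>. \<Sum>i=1..k. Z i \<omega>) \<in> borel_measurable M" for k
    by (intro borel_measurable_sum Zm) auto
  have bound: "prob {\<omega>\<in>space M. \<bar>\<Sum>i=1..N \<omega>. Z i \<omega>\<bar> > \<delta> * (x + real (N \<omega>))} \<le> K * x powr (- r) * W x"
    if x: "x > 0" for x
  proof -
    define A where "A k = {\<omega>\<in>space M. N \<omega> = k \<and> \<bar>\<Sum>i=1..k. Z i \<omega>\<bar> > \<delta> * (x + real k)}" for k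
    have Am [measurable]: "A k \<in> sets M" for k unfolding A_def by measurable
    define h where "h k = K * x powr (- r) * min (real k) (max 0 x) powr p'" for k :: nat
    have h0: "h k \<ge> 0" for k using C by (simp add: h_def K_def)
    have Ah: "prob (A k) \<le> h k * prob {\<omega>\<in>space M. N \<omega> = k}" for k
    proof -
      have "A k = (\<lambda>\<omega>. (real (N \<omega>), \<Sum>i=1..k. Z i \<omega>)) -` ({real k} \<times> {y. \<bar>y\<bar> > \<delta> * (x + real k)}) \<inter> space M"
        by (auto simp: A_def)
      also have "prob \<dots> = prob ((\<lambda>\<omega>. real (N \<omega>)) -` {real k} \<inter> space M) *
          prob ((\<lambda>\<omega>. \<Sum>i=1..k. Z i \<omega>) -` {y. \<bar>y\<bar> > \<delta> * (x + real k)} \<inter> space M)"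
        by (rule indep_varD[OF ind]) auto
      also have "(\<lambda>\<omega>. real (N \<omega>)) -` {real k} \<inter> space M = {\<omega>\<in>space M. N \<omega> = k}" by auto
      also have "(\<lambda>\<omega>. \<Sum>i=1..k. Z i \<omega>) -` {y. \<bar>y\<bar> > \<delta> * (x + real k)} \<inter> space M
          = {\<omega>\<in>space M. \<bar>\<Sum>i=1..k. Z i \<omega>\<bar> > \<delta> * (x + real k)}" by auto
      also have "prob {\<omega>\<in>space M. \<bar>\<Sum>i=1..k. Z i \<omega>\<bar> > \<delta> * (x + real k)}
          \<le> C * real k powr p * (\<delta> * (x + real k)) powr (- r)"
        using x \<delta> by (intro C(2) mult_pos_pos) auto
      also have "\<dots> = K * (real k powr p * (x + real k) powr (- r))"
        by (simp add: K_def powr_mult)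
      also have "\<dots> \<le> K * (x powr (- r) * min (real k) (max 0 x) powr p')"
        using C(1) p x by (intro mult_left_mono powr_div_add_powr_le) (auto simp: K_def)
      also have "\<dots> = h k" by (simp add: h_def)
      finally show ?thesis by (simp add: mult.commute mult_right_mono)
    qed
    have iW: "integrable M (\<lambda>\<omega>. h (N \<omega>))"
      unfolding h_def using p
      by (intro integrable_mult_right integrable_const_bound[where B = "max 0 x powr p'"]) (auto intro!: powr_mono2)
    have iN: "integrable M (\<lambda>\<omega>. h k * indicator {\<omega>\<in>space M. N \<omega> = k} \<omega>)" for k
      by (intro integrable_mult_right integrable_real_indicator) (auto simp: less_top[symmetric])
    \<comment> \<open>The conditioning is carried out on finitely many values of N with a bound
      uniform in n; countable additivity then passes to the limit.\<close>
    have partial: "(\<Sum>k<n. prob (A k)) \<le> K * x powr (- r) * W x" for n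
    proof -
      have "(\<Sum>k<n. prob (A k)) \<le> (\<Sum>k<n. h k * prob {\<omega>\<in>space M. N \<omega> = k})"
        by (intro sum_mono Ah)
      also have "\<dots> = expectation (\<lambda>\<omega>. \<Sum>k<n. h k * indicator {\<omega>\<in>space M. N \<omega> = k} \<omega>)"
        by (subst Bochner_Integration.integral_sum[OF iN]) simp
      also have "\<dots> \<le> expectation (\<lambda>\<omega>. h (N \<omega>))"
      proof (rule integral_mono)
        show "integrable M (\<lambda>\<omega>. \<Sum>k<n. h k * indicator {\<omega>\<in>space M. N \<omega> = k} \<omega>)"
          by (intro Bochner_Integration.integrable_sum iN)
        fix \<omega> assume w: "\<omega> \<in> space M"
        have "(\<Sum>k<n. h k * indicator {\<omega>\<in>space M. N \<omega> = k} \<omega>) = (\<Sum>k<n. if k = N \<omega> then h k else 0)"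
          using w by (intro sum.cong) auto
        also have "\<dots> \<le> h (N \<omega>)" using h0 by simp
        finally show "(\<Sum>k<n. h k * indicator {\<omega>\<in>space M. N \<omega> = k} \<omega>) \<le> h (N \<omega>)" .
      qed (rule iW)
      also have "\<dots> = K * x powr (- r) * W x" by (simp add: h_def W_def)
      finally show ?thesis .
    qed
    have "(\<lambda>k. prob (A k)) sums prob (\<Union>k. A k)"
    proof (rule finite_measure_UNION)
      show "range A \<subseteq> sets M" using Am by blast
      show "disjoint_family A" unfolding disjoint_family_on_def A_def by blast
    qed
    hence "prob (\<Union>k. A k) \<le> K * x powr (- r) * W x"
      unfolding sums_def using partial by (intro LIMSEQ_le_const2) auto
    also have "(\<Union>k. A k) = {\<omega>\<in>space M. \<bar>\<Sum>i=1..N \<omega>. Z i \<omega>\<bar> > \<delta> * (x + real (N \<omega>))}"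
      by (auto simp: A_def)
    finally show ?thesis .
  qed
  have "W \<in> O[at_top](\<lambda>x. x powr p' * f x)"
    unfolding W_def by (rule truncated_moment_bigo[OF N f p(4) tail])
  hence "(\<lambda>x. K * x powr (- r) * W x) \<in> O[at_top](\<lambda>x. x powr (- r) * (x powr p' * f x))"
    by (intro landau_o.big.mult) auto
  also have "(\<lambda>x. x powr (- r) * (x powr p' * f x)) \<in> o[at_top](f)"
  proof (rule smalloI_tendsto)
    have "((\<lambda>x::real. x powr (p' - r)) \<longlongrightarrow> 0) at_top"
      using p by (intro tendsto_neg_powr filterlim_ident) auto
    moreover have "eventually (\<lambda>x. x powr (p' - r) = x powr (- r) * (x powr p' * f x) / f x) at_top"
      using eventually_gt_at_top[of 0]
    proof eventually_elim
      case (elim x)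
      thus ?case using rv_tailD(3)[OF f, of x] by (simp flip: powr_add mult.assoc)
    qed
    ultimately show "((\<lambda>x. x powr (- r) * (x powr p' * f x) / f x) \<longlongrightarrow> 0) at_top"
      by (rule Lim_transform_eventually)
    show "\<forall>\<^sub>F x in at_top. f x \<noteq> 0"
      using rv_tailD(3)[OF f] by (auto intro!: always_eventually simp: less_imp_neq[symmetric])
  qed
  finally have small: "(\<lambda>x. K * x powr (- r) * W x) \<in> o[at_top](f)" .
  have le: "eventually (\<lambda>x. norm (prob {\<omega>\<in>space M. \<bar>\<Sum>i=1..N \<omega>. Z i \<omega>\<bar> > \<delta> * (x + real (N \<omega>))})
      \<le> 1 * norm (K * x powr (- r) * W x)) at_top"
    using eventually_gt_at_top[of 0]
    by eventually_elim (use bound in \<open>force intro: order_trans[OF _ abs_ge_self]\<close>)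
  show ?thesis by (rule landau_o.big_small_trans[OF bigoI[OF le] small])
qed

section \<open>Tails of linear combinations\<close>

lemma (in prob_space) tail_antimono:
  fixes X :: "'a \<Rightarrow> real"
  assumes [measurable]: "X \<in> borel_measurable M"
  shows "antimono (\<lambda>x. prob {\<omega>\<in>space M. X \<omega> > x})"
  by (intro antimonoI finite_measure_mono) auto

lemma (in prob_space) tail_tendsto_0:
  fixes X :: "'a \<Rightarrow> real"
  assumes [measurable]: "X \<in> borel_measurable M"
  shows "((\<lambda>x. prob {\<omega>\<in>space M. X \<omega> > x}) \<longlongrightarrow> 0) at_top"
proof -
  interpret D: real_distribution "distr M borel X" by simp
  have "cdf (distr M borel X) = (\<lambda>x. 1 - prob {\<omega>\<in>space M. X \<omega> > x})"
  proof
    fix x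
    have "cdf (distr M borel X) x = prob {\<omega>\<in>space M. X \<omega> \<le> x}"
      by (subst cdf_def, subst measure_distr) (auto intro!: arg_cong[where f = prob])
    also have "\<dots> = 1 - prob {\<omega>\<in>space M. X \<omega> > x}"
      by (subst prob_neg[symmetric]) (auto simp: not_less)
    finally show "cdf (distr M borel X) x = 1 - prob {\<omega>\<in>space M. X \<omega> > x}" .
  qed
  with D.cdf_lim_at_top_prob have "((\<lambda>x. 1 - prob {\<omega>\<in>space M. X \<omega> > x}) \<longlongrightarrow> 1) at_top"
    by simp
  from tendsto_diff[OF tendsto_const[of 1] this] show ?thesis by simp
qed

text \<open>Positivity of the tail is hidden in the convention 0 / 0 = 0: for q = 1 the quotient
  must tend to 1, so the tail is nonzero arbitrarily far out, and by monotonicity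
  everywhere.\<close>

lemma (in prob_space) rv_tail_of_regvar:
  assumes rv: "regvar M X \<beta>" and [measurable]: "X \<in> borel_measurable M"
  shows "rv_tail \<beta> (\<lambda>x. prob {\<omega>\<in>space M. X \<omega> > x})"
  unfolding rv_tail_def
proof (intro conjI allI impI)
  show "0 \<le> \<beta>" using rv by (simp add: regvar_def)
  show am: "antimono (\<lambda>x. prob {\<omega>\<in>space M. X \<omega> > x})" by (rule tail_antimono) measurable
  show "((\<lambda>x. prob {\<omega>\<in>space M. X \<omega> > x}) \<longlongrightarrow> 0) at_top" by (rule tail_tendsto_0) measurable
  show "((\<lambda>x. prob {\<omega>\<in>space M. X \<omega> > q * x} / prob {\<omega>\<in>space M. X \<omega> > x}) \<longlongrightarrow> q powr (- \<beta>)) at_top"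
    if "q > 0" for q using rv that by (simp add: regvar_def)
  fix x
  have "((\<lambda>x. prob {\<omega>\<in>space M. X \<omega> > 1 * x} / prob {\<omega>\<in>space M. X \<omega> > x}) \<longlongrightarrow> 1 powr (- \<beta>)) at_top"
    using rv unfolding regvar_def by (blast intro: zero_less_one)
  hence "eventually (\<lambda>x. prob {\<omega>\<in>space M. X \<omega> > x} / prob {\<omega>\<in>space M. X \<omega> > x} > 1/2) at_top"
    by (intro order_tendstoD(1)) auto
  then obtain y where y: "\<And>z. z \<ge> y \<Longrightarrow> prob {\<omega>\<in>space M. X \<omega> > z} / prob {\<omega>\<in>space M. X \<omega> > z} > 1/2"
    by (auto simp: eventually_at_top_linorder)
  have "prob {\<omega>\<in>space M. X \<omega> > max x y} \<noteq> 0" using y[of "max x y"] by auto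
  hence "0 < prob {\<omega>\<in>space M. X \<omega> > max x y}" by (simp add: zero_less_measure_iff)
  also have "\<dots> \<le> prob {\<omega>\<in>space M. X \<omega> > x}" using antimonoD[OF am, of x "max x y"] by simp
  finally show "0 < prob {\<omega>\<in>space M. X \<omega> > x}" .
qed

text \<open>One big jump: a large sum forces one summand to be nearly as large, unless both are of
  order x. By independence the latter has a probability that is a product of two tails, one of them
  comparable to its value at x and the other tending to 0.\<close>

lemma (in prob_space) tail_add_indep_equiv:
  fixes U V :: "'a \<Rightarrow> real"
  assumes ind: "indep_var borel U borel V"
    and nn: "\<And>\<omega>. U \<omega> \<ge> 0" "\<And>\<omega>. V \<omega> \<ge> 0"
    and F: "rv_tail \<beta> (\<lambda>x. prob {\<omega>\<in>space M. U \<omega> > x})"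
    and G: "rv_tail \<beta> (\<lambda>x. prob {\<omega>\<in>space M. V \<omega> > x})"
  shows "(\<lambda>x. prob {\<omega>\<in>space M. U \<omega> + V \<omega> > x})
    \<sim>[at_top] (\<lambda>x. prob {\<omega>\<in>space M. U \<omega> > x} + prob {\<omega>\<in>space M. V \<omega> > x})"
proof (rule rv_tail_sandwich[OF rv_tail_add[OF F G]])
  let ?F = "\<lambda>x. prob {\<omega>\<in>space M. U \<omega> > x}" and ?G = "\<lambda>x. prob {\<omega>\<in>space M. V \<omega> > x}"
  have [measurable]: "U \<in> borel_measurable M" "V \<in> borel_measurable M"
    using ind indep_var_rv1 indep_var_rv2 by blast+
  have both: "prob {\<omega>\<in>space M. U \<omega> > x \<and> V \<omega> > x} = ?F x * ?G x" for x
  proof -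
    have "{\<omega>\<in>space M. U \<omega> > x \<and> V \<omega> > x} = (\<lambda>\<omega>. (U \<omega>, V \<omega>)) -` ({x<..} \<times> {x<..}) \<inter> space M"
      by auto
    also have "prob \<dots> = prob (U -` {x<..} \<inter> space M) * prob (V -` {x<..} \<inter> space M)"
      by (rule indep_varD[OF ind]) auto
    also have "U -` {x<..} \<inter> space M = {\<omega>\<in>space M. U \<omega> > x}" by auto
    also have "V -` {x<..} \<inter> space M = {\<omega>\<in>space M. V \<omega> > x}" by auto
    finally show ?thesis .
  qed
  have prod: "(\<lambda>x. ?F (c * x) * ?G (c * x)) \<in> o[at_top](\<lambda>x. ?F x + ?G x)" if c: "c > 0" for c
  proof -
    have "?F \<in> O[at_top](\<lambda>x. ?F x + ?G x)"
      by (intro bigoI[of _ 1] always_eventually allI) simp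
    hence "(\<lambda>x. ?F (c * x)) \<in> O[at_top](\<lambda>x. ?F x + ?G x)"
      using rv_tail_scale_bigo[OF F c] landau_o.big_trans by blast
    moreover have "((\<lambda>x. ?G (c * x)) \<longlongrightarrow> 0) at_top"
      by (rule filterlim_compose[OF rv_tailD(4)[OF G] filterlim_scale_at_top[OF c]])
    hence "(\<lambda>x. ?G (c * x)) \<in> o[at_top](\<lambda>_. 1)" by (intro smalloI_tendsto) auto
    ultimately have "(\<lambda>x. ?F (c * x) * ?G (c * x)) \<in> o[at_top](\<lambda>x. (?F x + ?G x) * 1)"
      by (rule landau_o.big_small_mult)
    thus ?thesis by simp
  qed
  fix q :: real assume q: "q > 1"
  show "\<exists>e\<in>o[at_top](\<lambda>x. ?F x + ?G x). eventually (\<lambda>x. prob {\<omega>\<in>space M. U \<omega> + V \<omega> > x}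
          \<le> ?F (x / q) + ?G (x / q) + e x) at_top"
  proof (rule bexI)
    \<comment> \<open>If neither summand exceeds x / q, then each must exceed x - x / q = c x for
      the sum to exceed x.\<close>
    define c where "c = 1 - 1 / q"
    have c: "c > 0" using q by (simp add: c_def)
    show "(\<lambda>x. ?F (c * x) * ?G (c * x)) \<in> o[at_top](\<lambda>x. ?F x + ?G x)" by (rule prod[OF c])
    show "eventually (\<lambda>x. prob {\<omega>\<in>space M. U \<omega> + V \<omega> > x}
          \<le> ?F (x / q) + ?G (x / q) + ?F (c * x) * ?G (c * x)) at_top"
    proof (rule always_eventually, rule allI)
      fix x :: real
      have "x = x / q + c * x" by (simp add: c_def algebra_simps)
      hence "prob {\<omega>\<in>space M. U \<omega> + V \<omega> > x} \<le> prob ({\<omega>\<in>space M. U \<omega> > x / q} \<union> {\<omega>\<in>space M. V \<omega> > x / q}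
          \<union> {\<omega>\<in>space M. U \<omega> > c * x \<and> V \<omega> > c * x})"
        by (intro finite_measure_mono) auto
      also have "\<dots> \<le> prob ({\<omega>\<in>space M. U \<omega> > x / q} \<union> {\<omega>\<in>space M. V \<omega> > x / q})
          + prob {\<omega>\<in>space M. U \<omega> > c * x \<and> V \<omega> > c * x}"
        by (intro measure_Un_le) measurable
      also have "prob ({\<omega>\<in>space M. U \<omega> > x / q} \<union> {\<omega>\<in>space M. V \<omega> > x / q}) \<le> ?F (x / q) + ?G (x / q)"
        by (intro measure_Un_le) measurable
      finally show "prob {\<omega>\<in>space M. U \<omega> + V \<omega> > x} \<le> ?F (x / q) + ?G (x / q) + ?F (c * x) * ?G (c * x)"
        by (simp add: both)
    qed
  qed
  show "\<exists>e\<in>o[at_top](\<lambda>x. ?F x + ?G x). eventually (\<lambda>x. ?F (q * x) + ?G (q * x) - e x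
          \<le> prob {\<omega>\<in>space M. U \<omega> + V \<omega> > x}) at_top"
  proof (rule bexI)
    show "(\<lambda>x. ?F x * ?G x) \<in> o[at_top](\<lambda>x. ?F x + ?G x)" using prod[of 1] by simp
    show "eventually (\<lambda>x. ?F (q * x) + ?G (q * x) - ?F x * ?G x
          \<le> prob {\<omega>\<in>space M. U \<omega> + V \<omega> > x}) at_top"
      using eventually_ge_at_top[of 0]
    proof eventually_elim
      case (elim x)
      have "x * 1 \<le> x * q" using elim q by (intro mult_left_mono) auto
      \<comment> \<open>Inclusion-exclusion gives the lower bound at x itself; monotonicity only
        brings it into the form with q x that the sandwich expects.\<close>
      hence "?F (q * x) + ?G (q * x) \<le> ?F x + ?G x"
        by (intro add_mono rv_tailD(6)[OF F] rv_tailD(6)[OF G]) (auto simp: mult.commute)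
      moreover have "prob ({\<omega>\<in>space M. U \<omega> > x} \<union> {\<omega>\<in>space M. V \<omega> > x}) = ?F x + ?G x
          - prob ({\<omega>\<in>space M. U \<omega> > x} \<inter> {\<omega>\<in>space M. V \<omega> > x})"
        by (intro measure_Un3) (auto simp: fmeasurable_eq_sets)
      moreover have "{\<omega>\<in>space M. U \<omega> > x} \<inter> {\<omega>\<in>space M. V \<omega> > x} = {\<omega>\<in>space M. U \<omega> > x \<and> V \<omega> > x}"
        by auto
      moreover have "prob ({\<omega>\<in>space M. U \<omega> > x} \<union> {\<omega>\<in>space M. V \<omega> > x}) \<le> prob {\<omega>\<in>space M. U \<omega> + V \<omega> > x}"
        by (intro finite_measure_mono) (auto intro: less_le_trans[OF _ le_add_same_cancel1[THEN iffD2, OF nn(2)]]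
              less_le_trans[OF _ le_add_same_cancel2[THEN iffD2, OF nn(1)]])
      ultimately show ?case using both[of x] by simp
    qed
  qed
qed

lemma (in prob_space) tail_cmult_equiv:
  fixes U :: "'a \<Rightarrow> real"
  assumes F: "rv_tail \<beta> (\<lambda>x. prob {\<omega>\<in>space M. U \<omega> > x})" and a: "a > 0"
  shows "rv_tail \<beta> (\<lambda>x. prob {\<omega>\<in>space M. a * U \<omega> > x})"
    and "(\<lambda>x. prob {\<omega>\<in>space M. a * U \<omega> > x}) \<sim>[at_top] (\<lambda>x. a powr \<beta> * prob {\<omega>\<in>space M. U \<omega> > x})"
proof -
  have eq: "{\<omega>\<in>space M. a * U \<omega> > x} = {\<omega>\<in>space M. U \<omega> > 1 / a * x}" for x
    using a by (auto simp: field_simps)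
  show "rv_tail \<beta> (\<lambda>x. prob {\<omega>\<in>space M. a * U \<omega> > x})"
    unfolding eq using rv_tail_scale[OF F, of "1 / a"] a by simp
  have "(1 / a) powr (- \<beta>) = a powr \<beta>"
    using a by (simp add: powr_minus powr_divide)
  thus "(\<lambda>x. prob {\<omega>\<in>space M. a * U \<omega> > x}) \<sim>[at_top] (\<lambda>x. a powr \<beta> * prob {\<omega>\<in>space M. U \<omega> > x})"
    unfolding eq using rv_tail_scale_equiv[OF F, of "1 / a"] a by simp
qed

lemma (in prob_space) tail_lincomb_equiv:
  fixes U V :: "'a \<Rightarrow> real"
  assumes ind: "indep_var borel U borel V"
    and nn: "\<And>\<omega>. U \<omega> \<ge> 0" "\<And>\<omega>. V \<omega> \<ge> 0"
    and F: "rv_tail \<beta> (\<lambda>x. prob {\<omega>\<in>space M. U \<omega> > x})"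
    and G: "rv_tail \<beta> (\<lambda>x. prob {\<omega>\<in>space M. V \<omega> > x})"
    and ab: "a \<ge> 0" "b \<ge> 0" "a \<noteq> 0 \<or> b \<noteq> 0"
  shows "(\<lambda>x. prob {\<omega>\<in>space M. a * U \<omega> + b * V \<omega> > x}) \<sim>[at_top]
      (\<lambda>x. a powr \<beta> * prob {\<omega>\<in>space M. U \<omega> > x} + b powr \<beta> * prob {\<omega>\<in>space M. V \<omega> > x})" (is ?E)
    and "rv_tail \<beta> (\<lambda>x. prob {\<omega>\<in>space M. a * U \<omega> + b * V \<omega> > x})" (is ?R)
proof -
  have [measurable]: "U \<in> borel_measurable M" "V \<in> borel_measurable M"
    using ind indep_var_rv1 indep_var_rv2 by blast+
  consider "a = 0" "b > 0" | "b = 0" "a > 0" | "a > 0" "b > 0" using ab by force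
  hence "?E \<and> ?R"
  proof cases
    case 1 thus ?thesis using tail_cmult_equiv[OF G, of b] by simp
  next
    case 2 thus ?thesis using tail_cmult_equiv[OF F, of a] by simp
  next
    case 3
    have "indep_var borel (\<lambda>\<omega>. a * U \<omega>) borel (\<lambda>\<omega>. b * V \<omega>)"
      using indep_var_compose[OF ind, of "\<lambda>x. a * x" borel "\<lambda>x. b * x" borel] by (simp add: comp_def)
    hence eq: "(\<lambda>x. prob {\<omega>\<in>space M. a * U \<omega> + b * V \<omega> > x})
      \<sim>[at_top] (\<lambda>x. prob {\<omega>\<in>space M. a * U \<omega> > x} + prob {\<omega>\<in>space M. b * V \<omega> > x})"
      by (rule tail_add_indep_equiv) (use nn 3 tail_cmult_equiv(1)[OF F] tail_cmult_equiv(1)[OF G] in auto)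
    have E: ?E
      by (rule asymp_equiv_trans[OF eq]) (intro add_asymp_equiv tail_cmult_equiv F G 3; simp)
    have R0: "rv_tail \<beta> (\<lambda>x. prob {\<omega>\<in>space M. a * U \<omega> > x} + prob {\<omega>\<in>space M. b * V \<omega> > x})"
      by (intro rv_tail_add tail_cmult_equiv F G 3)
    have ?R unfolding rv_tail_def
    proof (intro conjI allI impI)
      show "0 \<le> \<beta>" by (rule rv_tailD[OF F])
      show "antimono (\<lambda>x. prob {\<omega>\<in>space M. a * U \<omega> + b * V \<omega> > x})" by (rule tail_antimono) measurable
      show "((\<lambda>x. prob {\<omega>\<in>space M. a * U \<omega> + b * V \<omega> > x}) \<longlongrightarrow> 0) at_top" by (rule tail_tendsto_0) measurable
      show "((\<lambda>x. prob {\<omega>\<in>space M. a * U \<omega> + b * V \<omega> > q * x} / prob {\<omega>\<in>space M. a * U \<omega> + b * V \<omega> > x})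
          \<longlongrightarrow> q powr (- \<beta>)) at_top" if "q > 0" for q
        by (rule rv_ratio_of_asymp_equiv[OF R0 eq that])
      fix x
      have "0 < prob {\<omega>\<in>space M. a * U \<omega> > x}" using rv_tailD(3)[OF tail_cmult_equiv(1)[OF F 3(1)]] .
      also have "\<dots> \<le> prob {\<omega>\<in>space M. a * U \<omega> + b * V \<omega> > x}"
        using 3 nn by (intro finite_measure_mono)
          (auto intro!: less_le_trans[OF _ le_add_same_cancel1[THEN iffD2]])
      finally show "0 < prob {\<omega>\<in>space M. a * U \<omega> + b * V \<omega> > x}" .
    qed
    with E show ?thesis by blast
  qed
  thus ?E ?R by auto
qed

section \<open>The branching process\<close>

text \<open>Injectivity turns a finite subfamily of the reindexed variables into a finite subfamily
  of the original ones, with the events pulled back along the inverse of h. It allows one generation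
  of offspring variables to be treated as a sequence.\<close>

lemma (in prob_space) indep_vars_reindex:
  assumes indep: "indep_vars M' X I" and h: "inj_on h J" "h ` J \<subseteq> I"
  shows "indep_vars (\<lambda>j. M' (h j)) (\<lambda>j. X (h j)) J"
  unfolding indep_vars_def2
proof (intro conjI ballI)
  show "random_variable (M' (h j)) (X (h j))" if "j \<in> J" for j
    using indep h that by (auto simp: indep_vars_def2)
  define F where "F i = {X i -` A \<inter> space M |A. A \<in> sets (M' i)}" for i
  have F: "indep_sets F I" using indep by (simp add: indep_vars_def2 F_def[abs_def])
  have "indep_sets (\<lambda>j. F (h j)) J"
  proof (rule indep_setsI)
    show "F (h j) \<subseteq> events" if "j \<in> J" for j
      using F h that by (auto simp: indep_sets_def)
    fix A K assume K: "K \<noteq> {}" "K \<subseteq> J" "finite K" and A: "\<forall>j\<in>K. A j \<in> F (h j)"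
    have inj: "inj_on h K" using h(1) K(2) by (rule inj_on_subset)
    have "prob (\<Inter>i\<in>h ` K. A (the_inv_into K h i)) = (\<Prod>i\<in>h ` K. prob (A (the_inv_into K h i)))"
      using K A h inj by (intro indep_setsD[OF F]) (auto simp: the_inv_into_f_f)
    thus "prob (\<Inter>j\<in>K. A j) = (\<Prod>j\<in>K. prob (A j))"
      using inj by (simp add: prod.reindex the_inv_into_f_f)
  qed
  thus "indep_sets (\<lambda>j. {X (h j) -` A \<inter> space M |A. A \<in> sets (M' (h j))}) J"
    by (simp add: F_def)
qed

lemma smallo_mono:
  fixes f g h :: "real \<Rightarrow> real"
  assumes "h \<in> o[at_top](f)" "eventually (\<lambda>x. 0 \<le> g x \<and> g x \<le> h x) at_top"
  shows "g \<in> o[at_top](f)"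
proof (rule landau_o.big_small_trans[OF bigoI assms(1)])
  show "eventually (\<lambda>x. norm (g x) \<le> 1 * norm (h x)) at_top"
    using assms(2) by eventually_elim auto
qed

section \<open>The mean recursion and its closed form\<close>

fun lin_rec :: "real \<Rightarrow> real \<Rightarrow> real \<Rightarrow> real \<Rightarrow> nat \<Rightarrow> real" where
  "lin_rec a b u v 0 = u"
| "lin_rec a b u v (Suc 0) = v"
| "lin_rec a b u v (Suc (Suc k)) = a * lin_rec a b u v (Suc k) + b * lin_rec a b u v k"

lemma lin_rec_nonneg:
  assumes "a \<ge> 0" "b \<ge> 0" "u \<ge> 0" "v \<ge> 0"
  shows "lin_rec a b u v k \<ge> 0"
  by (induction k rule: induct_nat_012) (use assms in auto)

text \<open>The sum of the two basic solutions is the solution started from (1, 1), and this stays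
  positive. A single basic solution may vanish: for a = 0 it is zero at every other index.\<close>

lemma lin_rec_pos:
  assumes "a \<ge> 0" "b \<ge> 0" "a > 0 \<or> b > 0"
  shows "lin_rec a b 0 1 k + lin_rec a b 1 0 k > 0"
proof (induction k rule: induct_nat_012)
  case (ge2 k)
  let ?c = "\<lambda>k. lin_rec a b 0 1 k + lin_rec a b 1 0 k"
  have "a * ?c (Suc k) + b * ?c k > 0"
    using ge2 assms by (auto intro: add_pos_nonneg add_nonneg_pos)
  thus ?case by (simp add: algebra_simps)
qed auto

text \<open>After one step the start (1, 0) has become (0, b), which is b times the start (0, 1).
  Index k stands for time k - 1, so this relates the coefficient of X_(-1) to that of X_0 one step
  earlier.\<close>

lemma lin_rec_shift: "lin_rec a b 1 0 (Suc k) = b * lin_rec a b 0 1 k"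
  by (induction k rule: induct_nat_012) (auto simp: algebra_simps)

text \<open>A Binet formula: both numbers \<open>lam_plus a b\<close> and
  \<open>lam_minus a b\<close> solve z^2 = a z + b, and they differ because the discriminant is
  positive. The separate value of \<open>mseq\<close> at 0 agrees with the quotient there.\<close>

lemma lin_rec_eq_mseq:
  assumes "a \<ge> 0" "b \<ge> 0" "a > 0 \<or> b > 0"
  shows "lin_rec a b 0 1 (Suc n) = mseq a b n"
proof -
  let ?l = "lam_plus a b" and ?m = "lam_minus a b"
  have D: "a\<^sup>2 + 4 * b > 0" using assms by (auto intro: add_pos_nonneg add_nonneg_pos)
  have diff: "?l - ?m = sqrt (a\<^sup>2 + 4 * b)" by (simp add: lam_plus_def lam_minus_def field_simps)
  have ne: "?l - ?m \<noteq> 0" unfolding diff using D by simp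
  have sq: "(sqrt (a\<^sup>2 + 4 * b))\<^sup>2 = a\<^sup>2 + 4 * b" using D by simp
  have lsq: "?l * ?l = a * ?l + b" "?m * ?m = a * ?m + b"
    using sq unfolding lam_plus_def lam_minus_def by (simp_all add: power2_eq_square field_simps)
  have "lin_rec a b 0 1 k * (?l - ?m) = ?l ^ k - ?m ^ k" for k
  proof (induction k rule: induct_nat_012)
    case (ge2 k)
    have "lin_rec a b 0 1 (Suc (Suc k)) * (?l - ?m) = a * (?l ^ Suc k - ?m ^ Suc k) + b * (?l ^ k - ?m ^ k)"
      by (simp only: lin_rec.simps(3) distrib_right mult.assoc ge2)
    also have "\<dots> = ?l ^ k * (a * ?l + b) - ?m ^ k * (a * ?m + b)" by (simp add: algebra_simps)
    also have "\<dots> = ?l ^ Suc (Suc k) - ?m ^ Suc (Suc k)" by (simp flip: lsq)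
    finally show ?case .
  qed auto
  hence "lin_rec a b 0 1 (Suc n) = (?l ^ Suc n - ?m ^ Suc n) / (?l - ?m)"
    using ne by (simp add: eq_divide_eq)
  thus ?thesis using ne by (cases n) (auto simp: mseq_def)
qed

section \<open>Measurability and dependence on the past\<close>

primrec gwi_time :: "gwi_index \<Rightarrow> nat" where
  "gwi_time I_Xm1 = 0"
| "gwi_time I_X0 = 0"
| "gwi_time (I_xi n i) = n"
| "gwi_time (I_eta n i) = n"
| "gwi_time (I_eps n) = n"

text \<open>Position j of the shifted process is time j - 1, so it involves only variables of
  generation at most t when j <= t + 1. The measure space is left general because the lemma is used
  both on \<open>M\<close> and on a product space of coordinates.\<close>

lemma gwi_shift_measurable:
  assumes meas: "\<And>i. i \<in> gwi_indices \<Longrightarrow> gwi_time i \<le> t \<Longrightarrow>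
      gwi_family Xm1 X0 xi eta eps i \<in> measurable L (count_space UNIV)"
  shows "j \<le> Suc t \<Longrightarrow> gwi_shift Xm1 X0 xi eta eps j \<in> measurable L (count_space UNIV)"
proof (induction j rule: induct_nat_012)
  case 0
  have "gwi_shift Xm1 X0 xi eta eps 0 = Xm1" by (rule ext) simp
  thus ?case using meas[of I_Xm1] by (simp add: gwi_indices_def gwi_family_def)
next
  case 1
  have "gwi_shift Xm1 X0 xi eta eps (Suc 0) = X0" by (rule ext) simp
  thus ?case using meas[of I_X0] by (simp add: gwi_indices_def gwi_family_def)
next
  case (ge2 k)
  have xi: "xi (Suc k) i \<in> measurable L (count_space UNIV)" if "1 \<le> i" for i
    using meas[of "I_xi (Suc k) i"] ge2.prems that by (auto simp: gwi_indices_def gwi_family_def)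
  have eta: "eta (Suc k) i \<in> measurable L (count_space UNIV)" if "1 \<le> i" for i
    using meas[of "I_eta (Suc k) i"] ge2.prems that by (auto simp: gwi_indices_def gwi_family_def)
  have [measurable]: "eps (Suc k) \<in> measurable L (count_space UNIV)"
    using meas[of "I_eps (Suc k)"] ge2.prems by (auto simp: gwi_indices_def gwi_family_def)
  have msum: "(\<lambda>\<omega>. \<Sum>i=1..m. z i \<omega>) \<in> measurable L (count_space UNIV)"
    if "\<And>i. 1 \<le> i \<Longrightarrow> z i \<in> measurable L (count_space UNIV)" for z :: "nat \<Rightarrow> 'a \<Rightarrow> nat" and m
    using that by (induction m) auto
  have [measurable]: "(\<lambda>\<omega>. \<Sum>i=1..gwi_shift Xm1 X0 xi eta eps (Suc k) \<omega>. xi (Suc k) i \<omega>) \<in> measurable L (count_space UNIV)"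
    using ge2 by (intro measurable_compose_countable[OF msum] xi) auto
  have [measurable]: "(\<lambda>\<omega>. \<Sum>i=1..gwi_shift Xm1 X0 xi eta eps k \<omega>. eta (Suc k) i \<omega>) \<in> measurable L (count_space UNIV)"
    using ge2 by (intro measurable_compose_countable[OF msum] eta) auto
  have "gwi_shift Xm1 X0 xi eta eps (Suc (Suc k)) = (\<lambda>\<omega>.
      (\<Sum>i=1..gwi_shift Xm1 X0 xi eta eps (Suc k) \<omega>. xi (Suc k) i \<omega>)
      + (\<Sum>i=1..gwi_shift Xm1 X0 xi eta eps k \<omega>. eta (Suc k) i \<omega>) + eps (Suc k) \<omega>)"
    by (rule ext) (rule gwi_shift.simps(3))
  thus ?case by (simp only:) measurable
qed

text \<open>Running the recursion on coordinate projections shows that the process factors through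
  the variables of the past, which is the form needed for independence of disjoint blocks.\<close>

lemma gwi_shift_restrict:
  fixes Y :: "gwi_index \<Rightarrow> 'a \<Rightarrow> nat"
  assumes A: "\<And>i. i \<in> gwi_indices \<Longrightarrow> gwi_time i \<le> t \<Longrightarrow> i \<in> A"
  shows "j \<le> Suc t \<Longrightarrow> gwi_shift (\<lambda>\<rho>. \<rho> I_Xm1) (\<lambda>\<rho>. \<rho> I_X0) (\<lambda>n i \<rho>. \<rho> (I_xi n i)) (\<lambda>n i \<rho>. \<rho> (I_eta n i))
       (\<lambda>n \<rho>. \<rho> (I_eps n)) j (restrict (\<lambda>i. gwi_family Xm1 X0 xi eta eps i \<omega>) A)
     = gwi_shift Xm1 X0 xi eta eps j \<omega>"
proof (induction j rule: induct_nat_012)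
  case 0
  show ?case using A[of I_Xm1] by (simp add: gwi_indices_def gwi_family_def)
next
  case 1
  show ?case using A[of I_X0] by (simp add: gwi_indices_def gwi_family_def)
next
  case (ge2 k)
  have "I_xi (Suc k) i \<in> A" "I_eta (Suc k) i \<in> A" "I_eps (Suc k) \<in> A" if "1 \<le> i" for i
    using A ge2.prems that by (auto simp: gwi_indices_def)
  thus ?case using ge2 by (auto simp: gwi_family_def intro!: sum.cong)
qed

section \<open>The process under the standing hypotheses\<close>

locale second_order_gwi = prob_space M
  for M :: "'a measure" +
  fixes Xm1 X0 :: "'a \<Rightarrow> nat"
    and xi eta :: "nat \<Rightarrow> nat \<Rightarrow> 'a \<Rightarrow> nat"
    and eps :: "nat \<Rightarrow> 'a \<Rightarrow> nat"
    and \<beta> r :: real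
  assumes indep: "indep_vars (\<lambda>_. count_space UNIV) (gwi_family Xm1 X0 xi eta eps) gwi_indices"
    and xi_id: "\<And>n i. 1 \<le> n \<Longrightarrow> 1 \<le> i \<Longrightarrow>
                  distr M (count_space UNIV) (xi n i) = distr M (count_space UNIV) (xi 1 1)"
    and eta_id: "\<And>n j. 1 \<le> n \<Longrightarrow> 1 \<le> j \<Longrightarrow>
                  distr M (count_space UNIV) (eta n j) = distr M (count_space UNIV) (eta 1 1)"
    and eps_id: "\<And>n. 1 \<le> n \<Longrightarrow>
                  distr M (count_space UNIV) (eps n) = distr M (count_space UNIV) (eps 1)"
    and rv0: "regvar M (\<lambda>\<omega>. real (X0 \<omega>)) \<beta>"
    and rvm1: "regvar M (\<lambda>\<omega>. real (Xm1 \<omega>)) \<beta>"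
    and r: "r > max 1 \<beta>"
    and mom_xi: "integrable M (\<lambda>\<omega>. real (xi 1 1 \<omega>) powr r)"
    and mom_eta: "integrable M (\<lambda>\<omega>. real (eta 1 1 \<omega>) powr r)"
    and mom_eps: "integrable M (\<lambda>\<omega>. real (eps 1 \<omega>) powr r)"
    and nondeg: "prob {\<omega> \<in> space M. xi 1 1 \<omega> = 0} < 1 \<or> prob {\<omega> \<in> space M. eta 1 1 \<omega> = 0} < 1"
begin

abbreviation X :: "nat \<Rightarrow> 'a \<Rightarrow> nat" where "X \<equiv> gwi_shift Xm1 X0 xi eta eps"

definition "mxi = expectation (\<lambda>\<omega>. real (xi 1 1 \<omega>))"
definition "meta = expectation (\<lambda>\<omega>. real (eta 1 1 \<omega>))"

text \<open>The conditional mean of the process without immigration, given the initial values.\<close>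

definition Y :: "nat \<Rightarrow> 'a \<Rightarrow> real" where
  "Y k \<omega> = lin_rec mxi meta 0 1 k * real (X0 \<omega>) + lin_rec mxi meta 1 0 k * real (Xm1 \<omega>)"

abbreviation T :: "nat \<Rightarrow> real \<Rightarrow> real" where
  "T k x \<equiv> prob {\<omega>\<in>space M. Y k \<omega> > x}"

lemma r1: "r > 1" and r\<beta>: "\<beta> < r" using r by auto

lemma family_measurable:
  "i \<in> gwi_indices \<Longrightarrow> gwi_family Xm1 X0 xi eta eps i \<in> measurable M (count_space UNIV)"
  using indep by (auto simp: indep_vars_def2)

lemma X0_measurable [measurable]: "X0 \<in> measurable M (count_space UNIV)"
  and Xm1_measurable [measurable]: "Xm1 \<in> measurable M (count_space UNIV)"
  using family_measurable[of I_X0] family_measurable[of I_Xm1]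
  by (simp_all add: gwi_indices_def gwi_family_def)

lemma offspring_measurable:
  assumes "1 \<le> n"
  shows "1 \<le> i \<Longrightarrow> xi n i \<in> measurable M (count_space UNIV)"
    and "1 \<le> i \<Longrightarrow> eta n i \<in> measurable M (count_space UNIV)"
    and "eps n \<in> measurable M (count_space UNIV)"
  using assms family_measurable[of "I_xi n i"] family_measurable[of "I_eta n i"] family_measurable[of "I_eps n"]
  by (auto simp: gwi_indices_def gwi_family_def)

lemma X_measurable [measurable]: "X k \<in> measurable M (count_space UNIV)"
  by (rule gwi_shift_measurable[where t = k]) (auto intro: family_measurable)

lemma Y_measurable [measurable]: "Y k \<in> borel_measurable M"
  unfolding Y_def by measurable

lemma m_nonneg: "mxi \<ge> 0" "meta \<ge> 0" by (auto simp: mxi_def meta_def)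

lemma Y_nonneg: "Y k \<omega> \<ge> 0"
  unfolding Y_def by (intro add_nonneg_nonneg mult_nonneg_nonneg lin_rec_nonneg m_nonneg) auto

lemma Y_Suc_Suc: "Y (Suc (Suc k)) \<omega> = mxi * Y (Suc k) \<omega> + meta * Y k \<omega>"
  by (simp add: Y_def algebra_simps)

lemma integrable_of_moment:
  fixes Z :: "'a \<Rightarrow> nat"
  assumes "integrable M (\<lambda>\<omega>. real (Z \<omega>) powr r)" and [measurable]: "Z \<in> measurable M (count_space UNIV)"
  shows "integrable M (\<lambda>\<omega>. real (Z \<omega>))"
  using integrable_powr_mono[of "\<lambda>\<omega>. real (Z \<omega>)" r 1] assms r1 by simp

lemma AE_zero_of_mean_zero:
  fixes Z :: "'a \<Rightarrow> nat"
  assumes mom: "integrable M (\<lambda>\<omega>. real (Z \<omega>) powr r)" and Z [measurable]: "Z \<in> measurable M (count_space UNIV)"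
    and 0: "expectation (\<lambda>\<omega>. real (Z \<omega>)) = 0"
  shows "AE \<omega> in M. Z \<omega> = 0"
  using integral_nonneg_eq_0_iff_AE[OF integrable_of_moment[OF mom Z]] 0 by simp

text \<open>A nonnegative variable with mean zero vanishes almost surely, so two zero means would
  contradict \<open>nondeg\<close>.\<close>

lemma m_pos: "mxi > 0 \<or> meta > 0"
proof (rule ccontr)
  assume "\<not> (mxi > 0 \<or> meta > 0)"
  hence 0: "mxi = 0" "meta = 0" using m_nonneg by auto
  have [measurable]: "xi 1 1 \<in> measurable M (count_space UNIV)" "eta 1 1 \<in> measurable M (count_space UNIV)"
    by (auto intro: offspring_measurable)
  have "AE \<omega> in M. xi 1 1 \<omega> = 0" "AE \<omega> in M. eta 1 1 \<omega> = 0"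
    using 0 unfolding mxi_def meta_def
    by (intro AE_zero_of_mean_zero mom_xi mom_eta; measurable)+
  hence "prob {\<omega> \<in> space M. xi 1 1 \<omega> = 0} = 1" "prob {\<omega> \<in> space M. eta 1 1 \<omega> = 0} = 1"
    by (subst prob_Collect_eq_1; measurable)+
  thus False using nondeg by simp
qed

text \<open>The process at position j is a function of the block of generations up to t, and
  \<open>B\<close> is a block of later generations; disjoint blocks of an independent family are
  independent.\<close>

lemma indep_past:
  assumes j: "j \<le> Suc t" and B: "B \<subseteq> gwi_indices" "\<And>i. i \<in> B \<Longrightarrow> t < gwi_time i"
    and g: "g \<in> borel_measurable (PiM B (\<lambda>_. count_space UNIV))"
  shows "indep_var borel (\<lambda>\<omega>. real (X j \<omega>)) borel (\<lambda>\<omega>. g (restrict (\<lambda>i. gwi_family Xm1 X0 xi eta eps i \<omega>) B))"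
proof -
  let ?A = "{i\<in>gwi_indices. gwi_time i \<le> t}"
  let ?h = "\<lambda>\<rho>. real (gwi_shift (\<lambda>\<rho>. \<rho> I_Xm1) (\<lambda>\<rho>. \<rho> I_X0) (\<lambda>n i \<rho>. \<rho> (I_xi n i)) (\<lambda>n i \<rho>. \<rho> (I_eta n i))
       (\<lambda>n \<rho>. \<rho> (I_eps n)) j \<rho>)"
  \<comment> \<open>On the product space the family built from coordinate projections is the
    coordinate itself, so the general measurability lemma applies there.\<close>
  have proj: "gwi_family (\<lambda>\<rho>. \<rho> I_Xm1) (\<lambda>\<rho>. \<rho> I_X0) (\<lambda>n i \<rho>. \<rho> (I_xi n i)) (\<lambda>n i \<rho>. \<rho> (I_eta n i))
       (\<lambda>n \<rho>. \<rho> (I_eps n)) i = (\<lambda>\<rho>. \<rho> i)" for i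
    by (cases i) (auto simp: gwi_family_def)
  have h: "?h \<in> borel_measurable (PiM ?A (\<lambda>_. count_space UNIV))"
    by (intro measurable_compose[OF gwi_shift_measurable[OF _ j]])
       (auto simp: proj intro!: measurable_component_singleton)
  have "indep_var borel (?h \<circ> (\<lambda>\<omega>. restrict (\<lambda>i. gwi_family Xm1 X0 xi eta eps i \<omega>) ?A))
      borel (g \<circ> (\<lambda>\<omega>. restrict (\<lambda>i. gwi_family Xm1 X0 xi eta eps i \<omega>) B))"
    using B by (intro indep_var_compose[OF indep_var_restrict[OF indep] h g]) force+
  thus ?thesis
    by (simp add: comp_def gwi_shift_restrict[OF _ j])
qed

text \<open>One statement for both kinds of offspring; \<open>h\<close> lists the indices of one
  generation. The threshold involves m X_j because only this product is comparable to the next mean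
  value. Accordingly the tail of X_j is assumed to be O(f) only for m > 0; for m = 0 the sum
  vanishes almost surely.\<close>

lemma offspring_deviation:
  fixes z :: "nat \<Rightarrow> 'a \<Rightarrow> nat" and zeta :: "'a \<Rightarrow> nat" and h :: "nat \<Rightarrow> gwi_index"
  assumes j: "j \<le> Suc t"
    and h: "inj_on h {1..}" "\<And>i. 1 \<le> i \<Longrightarrow> h i \<in> gwi_indices" "\<And>i. 1 \<le> i \<Longrightarrow> gwi_time (h i) = Suc t"
    and z: "\<And>i. 1 \<le> i \<Longrightarrow> gwi_family Xm1 X0 xi eta eps (h i) = z i"
    and zeta [measurable]: "zeta \<in> measurable M (count_space UNIV)"
    and id: "\<And>i. 1 \<le> i \<Longrightarrow> distr M (count_space UNIV) (z i) = distr M (count_space UNIV) zeta"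
    and mom: "integrable M (\<lambda>\<omega>. real (zeta \<omega>) powr r)"
    and m: "m = expectation (\<lambda>\<omega>. real (zeta \<omega>))"
    and f: "rv_tail \<beta> f"
    and tail: "m > 0 \<Longrightarrow> (\<lambda>x. prob {\<omega>\<in>space M. real (X j \<omega>) > x}) \<in> O[at_top](f)"
    and \<delta>: "\<delta> > 0"
  shows "(\<lambda>x. prob {\<omega>\<in>space M. \<bar>real (\<Sum>i=1..X j \<omega>. z i \<omega>) - m * real (X j \<omega>)\<bar> > \<delta> * (x + m * real (X j \<omega>))})
           \<in> o[at_top](f)"
proof -
  have zm: "z i \<in> measurable M (count_space UNIV)" if "1 \<le> i" for i
    using family_measurable[OF h(2)[OF that]] z[OF that] by simp
  have [measurable]: "(\<lambda>\<omega>. \<Sum>i=1..n. real (z i \<omega>)) \<in> borel_measurable M" for n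
  proof (rule borel_measurable_sum)
    fix i assume "i \<in> {1..n}"
    thus "(\<lambda>\<omega>. real (z i \<omega>)) \<in> borel_measurable M" using measurable_compose[OF zm, of i real borel] by auto
  qed
  have [measurable]: "(\<lambda>\<omega>. \<Sum>i=1..X j \<omega>. real (z i \<omega>)) \<in> borel_measurable M"
    by (rule measurable_compose_countable[where f = "\<lambda>n \<omega>. \<Sum>i=1..n. real (z i \<omega>)"]) measurable
  note intz = integrable_of_moment[OF mom zeta]
  have m0: "m \<ge> 0" by (simp add: m)
  show ?thesis
  proof (cases "m = 0")
    case True
    have "AE \<omega> in M. z i \<omega> = 0" if i: "1 \<le> i" for i
    proof -
      have "AE \<omega> in M. zeta \<omega> = 0" using AE_zero_of_mean_zero[OF mom zeta] True m by simp
      hence "AE y in distr M (count_space UNIV) zeta. y = 0" by (subst AE_distr_iff) auto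
      hence "AE y in distr M (count_space UNIV) (z i). y = 0" by (subst id[OF i])
      thus ?thesis using zm[OF i] by (subst (asm) AE_distr_iff) auto
    qed
    \<comment> \<open>The number of terms is random, so a single null set has to serve all
      i.\<close>
    hence "AE \<omega> in M. \<forall>i\<in>{1..}. z i \<omega> = 0" by (subst AE_ball_countable) auto
    hence "prob {\<omega>\<in>space M. \<bar>real (\<Sum>i=1..X j \<omega>. z i \<omega>) - m * real (X j \<omega>)\<bar> > \<delta> * (x + m * real (X j \<omega>))} = 0"
      if x: "x \<ge> 0" for x
    proof (intro prob_eq_0_AE, eventually_elim)
      case (elim \<omega>)
      hence "(\<Sum>i=1..X j \<omega>. z i \<omega>) = 0" by simp
      thus ?case using x \<delta> True by (simp add: not_less)
    qed
    hence "eventually (\<lambda>x. prob {\<omega>\<in>space M. \<bar>real (\<Sum>i=1..X j \<omega>. z i \<omega>) - m * real (X j \<omega>)\<bar> > \<delta> * (x + m * real (X j \<omega>))} = 0) at_top"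
      using eventually_ge_at_top[of 0] by (rule eventually_mono[rotated])
    thus ?thesis by (subst landau_o.small.in_cong[where g = "\<lambda>_. 0"]) auto
  next
    case False
    hence mp: "m > 0" using m0 by simp
    define Z where "Z i \<omega> = real (z i \<omega>) - m" for i \<omega>
    have transfer: "distr M borel (\<lambda>\<omega>. u (z i \<omega>)) = distr M borel (\<lambda>\<omega>. u (zeta \<omega>))"
      if i: "1 \<le> i" for i and u :: "nat \<Rightarrow> real"
      using distr_distr[of u "count_space UNIV" borel "z i" M] distr_distr[of u "count_space UNIV" borel zeta M]
        zm[OF i] zeta id[OF i] by (simp add: comp_def)
    have "indep_vars (\<lambda>_. count_space UNIV) (\<lambda>i. gwi_family Xm1 X0 xi eta eps (h i)) {1..}"
      using indep_vars_reindex[OF indep h(1)] h(2) by auto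
    hence "indep_vars (\<lambda>_. count_space UNIV) z {1..}"
      using z by (subst indep_vars_cong[OF refl, where Y = "\<lambda>i. gwi_family Xm1 X0 xi eta eps (h i)"]) auto
    hence Zind: "indep_vars (\<lambda>_. borel) Z {1..}"
      unfolding Z_def by (rule indep_vars_compose2) auto
    have Zid: "distr M borel (Z i) = distr M borel (\<lambda>\<omega>. real (zeta \<omega>) - m)" if "1 \<le> i" for i
      using transfer[OF that, of "\<lambda>n. real n - m"] by (simp add: Z_def[abs_def])
    have [measurable]: "Z 1 \<in> borel_measurable M" using Zind by (auto simp: indep_vars_def2)
    have "expectation (Z 1) = integral\<^sup>L (distr M borel (Z 1)) (\<lambda>y. y)"
      by (subst integral_distr) measurable
    also have "\<dots> = expectation (\<lambda>\<omega>. real (zeta \<omega>) - m)"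
      by (subst Zid, simp, subst integral_distr) measurable
    also have "\<dots> = 0" using intz by (simp add: m prob_space)
    finally have Zmean: "expectation (Z 1) = 0" .
    have "integrable M (\<lambda>\<omega>. \<bar>real (zeta \<omega>) - m\<bar> powr r)"
    proof (rule Bochner_Integration.integrable_bound)
      show "integrable M (\<lambda>\<omega>. 2 powr r * (real (zeta \<omega>) powr r + m powr r))"
        using mom by auto
      have "\<bar>real n - m\<bar> powr r \<le> 2 powr r * (real n powr r + m powr r)" for n
      proof -
        have "\<bar>real n - m\<bar> powr r \<le> (2 * max (real n) m) powr r"
          using m0 r1 by (intro powr_mono2) auto
        also have "\<dots> = 2 powr r * max (real n) m powr r" by (simp add: powr_mult)
        also have "\<dots> \<le> 2 powr r * (real n powr r + m powr r)"
          by (intro mult_left_mono) (auto simp: max_def)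
        finally show ?thesis .
      qed
      thus "AE \<omega> in M. norm (\<bar>real (zeta \<omega>) - m\<bar> powr r) \<le> norm (2 powr r * (real (zeta \<omega>) powr r + m powr r))"
        by (intro AE_I2) (auto simp: abs_of_nonneg)
    qed measurable
    hence "integrable (distr M borel (\<lambda>\<omega>. real (zeta \<omega>) - m)) (\<lambda>y. \<bar>y\<bar> powr r)"
      by (subst integrable_distr_eq) auto
    hence "integrable (distr M borel (Z 1)) (\<lambda>y. \<bar>y\<bar> powr r)" by (simp add: Zid)
    hence Zint: "integrable M (\<lambda>\<omega>. \<bar>Z 1 \<omega>\<bar> powr r)"
      by (subst (asm) integrable_distr_eq; (assumption | measurable))
    have ind: "indep_var borel (\<lambda>\<omega>. real (X j \<omega>)) borel (\<lambda>\<omega>. \<Sum>i=1..k. Z i \<omega>)" for k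
    proof -
      have "indep_var borel (\<lambda>\<omega>. real (X j \<omega>)) borel
         (\<lambda>\<omega>. (\<lambda>\<rho>. \<Sum>i=1..k. real (\<rho> (h i)) - m) (restrict (\<lambda>i. gwi_family Xm1 X0 xi eta eps i \<omega>) (h ` {1..k})))"
        using h by (intro indep_past[OF j]) auto
      also have "(\<lambda>\<omega>. (\<lambda>\<rho>. \<Sum>i=1..k. real (\<rho> (h i)) - m) (restrict (\<lambda>i. gwi_family Xm1 X0 xi eta eps i \<omega>) (h ` {1..k})))
         = (\<lambda>\<omega>. \<Sum>i=1..k. Z i \<omega>)"
        by (intro ext) (auto simp: Z_def z intro!: sum.cong)
      finally show ?thesis .
    qed
    \<comment> \<open>Chosen so that \<delta>' (x + n) <= \<delta> (x + m n) for x >= 0.\<close>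
    define \<delta>' where "\<delta>' = \<delta> * min 1 m"
    have \<delta>': "\<delta>' > 0" using \<delta> mp by (simp add: \<delta>'_def)
    have "(\<lambda>x. prob {\<omega>\<in>space M. \<bar>\<Sum>i=1..X j \<omega>. Z i \<omega>\<bar> > \<delta>' * (x + real (X j \<omega>))}) \<in> o[at_top](f)"
      by (rule random_sum_deviation[OF Zind _ r1 r\<beta> Zint Zmean X_measurable ind f tail[OF mp] \<delta>'])
         (simp add: Zid)
    thus ?thesis
    proof (rule smallo_mono)
      show "eventually (\<lambda>x. 0 \<le> prob {\<omega>\<in>space M. \<bar>real (\<Sum>i=1..X j \<omega>. z i \<omega>) - m * real (X j \<omega>)\<bar> > \<delta> * (x + m * real (X j \<omega>))}
         \<and> prob {\<omega>\<in>space M. \<bar>real (\<Sum>i=1..X j \<omega>. z i \<omega>) - m * real (X j \<omega>)\<bar> > \<delta> * (x + m * real (X j \<omega>))}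
         \<le> prob {\<omega>\<in>space M. \<bar>\<Sum>i=1..X j \<omega>. Z i \<omega>\<bar> > \<delta>' * (x + real (X j \<omega>))}) at_top"
        using eventually_ge_at_top[of 0]
      proof eventually_elim
        case (elim x)
        have Zs: "(\<Sum>i=1..n. Z i \<omega>) = real (\<Sum>i=1..n. z i \<omega>) - m * real n" for n \<omega>
          by (simp add: Z_def sum_subtractf)
        have le: "\<delta>' * (x + real n) \<le> \<delta> * (x + m * real n)" for n
        proof -
          have "min 1 m * x \<le> 1 * x" "min 1 m * real n \<le> m * real n"
            using elim by (intro mult_right_mono; simp)+
          hence "min 1 m * (x + real n) \<le> x + m * real n" by (simp add: distrib_left)
          thus ?thesis unfolding \<delta>'_def mult.assoc using \<delta> by (intro mult_left_mono) auto
        qed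
        have "prob {\<omega>\<in>space M. \<bar>real (\<Sum>i=1..X j \<omega>. z i \<omega>) - m * real (X j \<omega>)\<bar> > \<delta> * (x + m * real (X j \<omega>))}
         \<le> prob {\<omega>\<in>space M. \<bar>real (\<Sum>i=1..X j \<omega>. z i \<omega>) - m * real (X j \<omega>)\<bar> > \<delta>' * (x + real (X j \<omega>))}"
          unfolding of_nat_sum
          by (rule finite_measure_mono, blast intro: le_less_trans[OF le]) measurable
        thus ?case by (simp only: Zs) simp
      qed
    qed
  qed
qed

text \<open>Markov's inequality of order r gives a multiple of x^(-r), and r > \<beta> makes this
  negligible against every tail of index \<beta>.\<close>

lemma immigration_tail:
  assumes n: "1 \<le> n" and f: "rv_tail \<beta> f" and \<delta>: "\<delta> > 0"
  shows "(\<lambda>x. prob {\<omega>\<in>space M. real (eps n \<omega>) > \<delta> * x}) \<in> o[at_top](f)"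
proof -
  note [measurable] = offspring_measurable(3)[OF n] offspring_measurable(3)[of 1, simplified]
  define c where "c = expectation (\<lambda>\<omega>. real (eps 1 \<omega>) powr r)"
  have eq: "prob {\<omega>\<in>space M. real (eps n \<omega>) > y} = prob {\<omega>\<in>space M. real (eps 1 \<omega>) > y}" for y
  proof -
    have "prob {\<omega>\<in>space M. real (eps i \<omega>) > y} = measure (distr M (count_space UNIV) (eps i)) {k. real k > y}"
      if "eps i \<in> measurable M (count_space UNIV)" for i
      using that by (subst measure_distr) (auto intro!: arg_cong[where f = prob])
    from this[of n] this[of 1] show ?thesis using eps_id[OF n] by simp
  qed
  have "(\<lambda>x. c * \<delta> powr (- r) * x powr (- r)) \<in> o[at_top](f)"
    using powr_smallo_rv_tail[OF f r\<beta>] by (cases "c * \<delta> powr (- r) = 0") auto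
  thus ?thesis
  proof (rule smallo_mono)
    show "eventually (\<lambda>x. 0 \<le> prob {\<omega>\<in>space M. real (eps n \<omega>) > \<delta> * x}
       \<and> prob {\<omega>\<in>space M. real (eps n \<omega>) > \<delta> * x} \<le> c * \<delta> powr (- r) * x powr (- r)) at_top"
      using eventually_gt_at_top[of 0]
    proof eventually_elim
      case (elim x)
      have "prob {\<omega>\<in>space M. real (eps 1 \<omega>) > \<delta> * x} \<le> prob {\<omega>\<in>space M. real (eps 1 \<omega>) powr r \<ge> (\<delta> * x) powr r}"
        using elim \<delta> r1 by (intro finite_measure_mono Collect_mono conj_mono imp_refl impI powr_mono2) auto
      also have "\<dots> \<le> expectation (\<lambda>\<omega>. real (eps 1 \<omega>) powr r) / (\<delta> * x) powr r"
        by (rule integral_Markov_inequality_measure[OF mom_eps, where A = "{}"]) (use elim \<delta> in auto)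
      also have "\<dots> = c * \<delta> powr (- r) * x powr (- r)"
        by (simp add: c_def powr_mult powr_minus divide_inverse)
      finally show ?case by (simp add: eq)
    qed
  qed
qed

lemma indep_initial: "indep_var borel (\<lambda>\<omega>. real (X0 \<omega>)) borel (\<lambda>\<omega>. real (Xm1 \<omega>))"
proof -
  have "indep_var borel ((\<lambda>\<rho>. real (\<rho> I_X0)) \<circ> (\<lambda>\<omega>. restrict (\<lambda>i. gwi_family Xm1 X0 xi eta eps i \<omega>) {I_X0}))
      borel ((\<lambda>\<rho>. real (\<rho> I_Xm1)) \<circ> (\<lambda>\<omega>. restrict (\<lambda>i. gwi_family Xm1 X0 xi eta eps i \<omega>) {I_Xm1}))"
    by (intro indep_var_compose[OF indep_var_restrict[OF indep]]) (auto simp: gwi_indices_def)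
  thus ?thesis by (simp add: comp_def gwi_family_def)
qed

section \<open>Tails of the mean process and concentration around it\<close>

lemma T_equiv: "T k \<sim>[at_top] (\<lambda>x. lin_rec mxi meta 0 1 k powr \<beta> * prob {\<omega>\<in>space M. real (X0 \<omega>) > x}
      + lin_rec mxi meta 1 0 k powr \<beta> * prob {\<omega>\<in>space M. real (Xm1 \<omega>) > x})"
  and T_rv_tail: "rv_tail \<beta> (T k)"
proof -
  have "lin_rec mxi meta 0 1 k \<noteq> 0 \<or> lin_rec mxi meta 1 0 k \<noteq> 0"
    using lin_rec_pos[OF m_nonneg m_pos, of k] by auto
  note tail_lincomb_equiv[OF indep_initial _ _ rv_tail_of_regvar[OF rv0] rv_tail_of_regvar[OF rvm1]
      lin_rec_nonneg[OF m_nonneg] lin_rec_nonneg[OF m_nonneg] this]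
  thus "T k \<sim>[at_top] (\<lambda>x. lin_rec mxi meta 0 1 k powr \<beta> * prob {\<omega>\<in>space M. real (X0 \<omega>) > x}
      + lin_rec mxi meta 1 0 k powr \<beta> * prob {\<omega>\<in>space M. real (Xm1 \<omega>) > x})"
    "rv_tail \<beta> (T k)"
    unfolding Y_def by auto
qed

text \<open>Domination up to a constant shifts the argument of the tail by that constant, and
  regular variation absorbs the shift.\<close>

lemma T_bigo:
  assumes c: "c > 0" and le: "\<And>\<omega>. c * Y j \<omega> \<le> Y l \<omega>"
  shows "T j \<in> O[at_top](T l)"
proof -
  have "T j x \<le> T l (c * x)" for x
    using c by (intro finite_measure_mono) (auto intro: less_le_trans[OF _ le])
  hence "T j \<in> O[at_top](\<lambda>x. T l (c * x))" by (intro bigoI[of _ 1] always_eventually allI) simp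
  also have "(\<lambda>x. T l (c * x)) \<in> O[at_top](T l)" by (rule rv_tail_scale_bigo[OF T_rv_tail c])
  finally show ?thesis .
qed

text \<open>The deviation is measured relative to \<^term>\<open>x + Y k \<omega>\<close> and not to \<^term>\<open>x\<close> alone: for \<open>\<beta> = 0\<close>
  the fluctuations of a sum of order \<open>x\<^sup>2\<close> many terms already exceed \<open>x\<close>, on an event whose probability
  need not be negligible. Comparing with \<^term>\<open>T k\<close>, and not with the sum of both initial tails, matters when
  one of the initial values does not contribute to \<^term>\<open>X k\<close>.\<close>

definition concentrated :: "nat \<Rightarrow> bool" where
  "concentrated k \<longleftrightarrow> (\<forall>\<delta>>0. (\<lambda>x. prob {\<omega>\<in>space M. \<bar>real (X k \<omega>) - Y k \<omega>\<bar> > \<delta> * (x + Y k \<omega>)}) \<in> o[at_top](T k))"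

text \<open>Off the deviation event, X_k > x gives x - Y_k < \<delta> (x + Y_k), that is (1 -
  \<delta>) x < (1 + \<delta>) Y_k. The lower bound below is the same computation with the roles
  exchanged.\<close>

lemma concentrated_upper:
  assumes \<delta>: "0 < \<delta>" "\<delta> < 1"
  shows "prob {\<omega>\<in>space M. real (X k \<omega>) > x}
    \<le> T k ((1 - \<delta>) / (1 + \<delta>) * x) + prob {\<omega>\<in>space M. \<bar>real (X k \<omega>) - Y k \<omega>\<bar> > \<delta> * (x + Y k \<omega>)}"
proof -
  have "prob {\<omega>\<in>space M. real (X k \<omega>) > x} \<le> prob ({\<omega>\<in>space M. Y k \<omega> > (1 - \<delta>) / (1 + \<delta>) * x}
      \<union> {\<omega>\<in>space M. \<bar>real (X k \<omega>) - Y k \<omega>\<bar> > \<delta> * (x + Y k \<omega>)})"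
  proof (rule finite_measure_mono)
    have "(1 - \<delta>) / (1 + \<delta>) * x < Y k \<omega>" if "x < real (X k \<omega>)" "\<bar>real (X k \<omega>) - Y k \<omega>\<bar> \<le> \<delta> * (x + Y k \<omega>)" for \<omega>
    proof -
      have "(1 - \<delta>) * x < (1 + \<delta>) * Y k \<omega>" using that by (simp add: algebra_simps abs_le_iff)
      thus ?thesis using \<delta> by (simp add: field_simps)
    qed
    thus "{\<omega>\<in>space M. real (X k \<omega>) > x} \<subseteq> {\<omega>\<in>space M. Y k \<omega> > (1 - \<delta>) / (1 + \<delta>) * x}
      \<union> {\<omega>\<in>space M. \<bar>real (X k \<omega>) - Y k \<omega>\<bar> > \<delta> * (x + Y k \<omega>)}"
      by (force simp: not_less)
  qed measurable
  also have "\<dots> \<le> T k ((1 - \<delta>) / (1 + \<delta>) * x) + prob {\<omega>\<in>space M. \<bar>real (X k \<omega>) - Y k \<omega>\<bar> > \<delta> * (x + Y k \<omega>)}"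
    by (rule measure_Un_le) measurable
  finally show ?thesis .
qed

lemma concentrated_lower:
  assumes \<delta>: "0 < \<delta>" "\<delta> < 1"
  shows "T k ((1 + \<delta>) / (1 - \<delta>) * x) - prob {\<omega>\<in>space M. \<bar>real (X k \<omega>) - Y k \<omega>\<bar> > \<delta> * (x + Y k \<omega>)}
    \<le> prob {\<omega>\<in>space M. real (X k \<omega>) > x}"
proof -
  have "T k ((1 + \<delta>) / (1 - \<delta>) * x) \<le> prob ({\<omega>\<in>space M. real (X k \<omega>) > x}
      \<union> {\<omega>\<in>space M. \<bar>real (X k \<omega>) - Y k \<omega>\<bar> > \<delta> * (x + Y k \<omega>)})"
  proof (rule finite_measure_mono)
    have "x < real (X k \<omega>)" if "(1 + \<delta>) / (1 - \<delta>) * x < Y k \<omega>" "\<bar>real (X k \<omega>) - Y k \<omega>\<bar> \<le> \<delta> * (x + Y k \<omega>)" for \<omega>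
    proof -
      have "(1 + \<delta>) * x < (1 - \<delta>) * Y k \<omega>" using that(1) \<delta> by (simp add: field_simps)
      thus ?thesis using that(2) by (simp add: algebra_simps abs_le_iff)
    qed
    thus "{\<omega>\<in>space M. Y k \<omega> > (1 + \<delta>) / (1 - \<delta>) * x} \<subseteq> {\<omega>\<in>space M. real (X k \<omega>) > x}
      \<union> {\<omega>\<in>space M. \<bar>real (X k \<omega>) - Y k \<omega>\<bar> > \<delta> * (x + Y k \<omega>)}"
      by (force simp: not_less)
  qed measurable
  also have "\<dots> \<le> prob {\<omega>\<in>space M. real (X k \<omega>) > x} + prob {\<omega>\<in>space M. \<bar>real (X k \<omega>) - Y k \<omega>\<bar> > \<delta> * (x + Y k \<omega>)}"
    by (rule measure_Un_le) measurable
  finally show ?thesis by simp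
qed

lemma concentrated_tail_equiv:
  assumes "concentrated k"
  shows "(\<lambda>x. prob {\<omega>\<in>space M. real (X k \<omega>) > x}) \<sim>[at_top] T k"
proof (rule rv_tail_sandwich[OF T_rv_tail])
  fix q :: real assume q: "q > 1"
  \<comment> \<open>The solution of (1 + \<delta>) / (1 - \<delta>) = q, so that the two
    concentration bounds become the sandwich for q.\<close>
  define \<delta> where "\<delta> = (q - 1) / (q + 1)"
  have \<delta>: "0 < \<delta>" "\<delta> < 1" using q by (auto simp: \<delta>_def)
  have "1 + \<delta> = 2 * q / (q + 1)" "1 - \<delta> = 2 / (q + 1)" using q by (auto simp: \<delta>_def field_simps)
  hence eq: "(1 + \<delta>) / (1 - \<delta>) = q" using q by auto
  hence eq': "(1 - \<delta>) / (1 + \<delta>) = 1 / q" using q \<delta> by (auto simp: field_simps)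
  have e: "(\<lambda>x. prob {\<omega>\<in>space M. \<bar>real (X k \<omega>) - Y k \<omega>\<bar> > \<delta> * (x + Y k \<omega>)}) \<in> o[at_top](T k)"
    using assms \<delta> by (simp add: concentrated_def)
  show "\<exists>e\<in>o[at_top](T k). eventually (\<lambda>x. prob {\<omega>\<in>space M. real (X k \<omega>) > x} \<le> T k (x / q) + e x) at_top"
    by (rule bexI[OF _ e]) (use concentrated_upper[OF \<delta>, where k = k] in \<open>simp add: eq'\<close>)
  show "\<exists>e\<in>o[at_top](T k). eventually (\<lambda>x. T k (q * x) - e x \<le> prob {\<omega>\<in>space M. real (X k \<omega>) > x}) at_top"
    by (rule bexI[OF _ e]) (use concentrated_lower[OF \<delta>, where k = k] in \<open>simp only: eq eventually_True\<close>)
qed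

text \<open>Off five exceptional events the deviation is controlled deterministically: the two
  centred sums, the immigration, and the deviations inherited from the two previous positions. Each
  event is negligible against the new tail, since a predecessor with positive mean factor has a tail
  dominated by it.\<close>

lemma concentrated_step:
  assumes C1: "concentrated (Suc k)" and C0: "concentrated k"
  shows "concentrated (Suc (Suc k))"
  unfolding concentrated_def
proof (intro allI impI)
  fix \<delta> :: real assume \<delta>: "\<delta> > 0"
  let ?T = "T (Suc (Suc k))"
  note f = T_rv_tail[of "Suc (Suc k)"]
  \<comment> \<open>The cap 1 gives X <= x + 2 Y for the predecessors. Substituting this, the five
    errors add up to d times (3 + 2 mxi + 2 meta) x + 3 Y, which fixes the denominator.\<close>
  define d where "d = min 1 (\<delta> / (3 + 2 * mxi + 2 * meta))"
  have pos: "3 + 2 * mxi + 2 * meta > 0" using m_nonneg by linarith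
  have d: "d > 0" "d \<le> 1" using \<delta> pos by (auto simp: d_def)
  have d\<delta>: "d * (3 + 2 * mxi + 2 * meta) \<le> \<delta>"
    using pos by (simp add: d_def flip: pos_le_divide_eq)
  define S1 where "S1 \<omega> = (\<Sum>i=1..X (Suc k) \<omega>. xi (Suc k) i \<omega>)" for \<omega>
  define S2 where "S2 \<omega> = (\<Sum>i=1..X k \<omega>. eta (Suc k) i \<omega>)" for \<omega>
  define E1 where "E1 x = {\<omega>\<in>space M. \<bar>real (S1 \<omega>) - mxi * real (X (Suc k) \<omega>)\<bar> > d * (x + mxi * real (X (Suc k) \<omega>))}" for x
  define E2 where "E2 x = {\<omega>\<in>space M. \<bar>real (S2 \<omega>) - meta * real (X k \<omega>)\<bar> > d * (x + meta * real (X k \<omega>))}" for x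
  define E3 where "E3 x = {\<omega>\<in>space M. real (eps (Suc k) \<omega>) > d * x}" for x
  \<comment> \<open>For \<open>mxi = 0\<close> the tail of the predecessor need not be O of the new
    tail, so its deviation event could not be absorbed; its contribution carries the factor
    \<open>mxi\<close> and drops out. The same holds for \<open>E5\<close> and
    \<open>meta\<close>.\<close>
  define E4 where "E4 x = (if mxi = 0 then {} else {\<omega>\<in>space M. \<bar>real (X (Suc k) \<omega>) - Y (Suc k) \<omega>\<bar> > d * (x + Y (Suc k) \<omega>)})" for x
  define E5 where "E5 x = (if meta = 0 then {} else {\<omega>\<in>space M. \<bar>real (X k \<omega>) - Y k \<omega>\<bar> > d * (x + Y k \<omega>)})" for x
  have bigT: "T (Suc k) \<in> O[at_top](?T)" if "mxi > 0"
    using that m_nonneg Y_nonneg by (intro T_bigo[of mxi]) (auto simp: Y_Suc_Suc)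
  have bigT': "T k \<in> O[at_top](?T)" if "meta > 0"
    using that m_nonneg Y_nonneg by (intro T_bigo[of meta]) (auto simp: Y_Suc_Suc)
  have tailX: "(\<lambda>x. prob {\<omega>\<in>space M. real (X j \<omega>) > x}) \<in> O[at_top](T j)" if "concentrated j" for j
    by (rule asymp_equiv_imp_bigo[OF concentrated_tail_equiv[OF that]])
  have o1: "(\<lambda>x. prob (E1 x)) \<in> o[at_top](?T)"
    unfolding E1_def S1_def
  proof (rule offspring_deviation[where h = "I_xi (Suc k)" and t = k and zeta = "xi 1 1"])
    show "(\<lambda>x. prob {\<omega>\<in>space M. real (X (Suc k) \<omega>) > x}) \<in> O[at_top](?T)" if "mxi > 0"
      using landau_o.big_trans[OF tailX[OF C1] bigT[OF that]] .
    show "inj_on (I_xi (Suc k)) {1..}" by (simp add: inj_on_def)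
    show "integrable M (\<lambda>\<omega>. real (xi 1 1 \<omega>) powr r)" by (rule mom_xi)
    show "xi 1 1 \<in> measurable M (count_space UNIV)" by (intro offspring_measurable) simp_all
    show "distr M (count_space UNIV) (xi (Suc k) i) = distr M (count_space UNIV) (xi 1 1)" if "1 \<le> i" for i
      using that by (intro xi_id) simp_all
    show "gwi_family Xm1 X0 xi eta eps (I_xi (Suc k) i) = xi (Suc k) i" for i by (simp add: gwi_family_def)
  qed (use d in \<open>simp_all add: gwi_indices_def mxi_def f\<close>)
  have o2: "(\<lambda>x. prob (E2 x)) \<in> o[at_top](?T)"
    unfolding E2_def S2_def
  proof (rule offspring_deviation[where h = "I_eta (Suc k)" and t = k and zeta = "eta 1 1"])
    show "(\<lambda>x. prob {\<omega>\<in>space M. real (X k \<omega>) > x}) \<in> O[at_top](?T)" if "meta > 0"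
      using landau_o.big_trans[OF tailX[OF C0] bigT'[OF that]] .
    show "inj_on (I_eta (Suc k)) {1..}" by (simp add: inj_on_def)
    show "integrable M (\<lambda>\<omega>. real (eta 1 1 \<omega>) powr r)" by (rule mom_eta)
    show "eta 1 1 \<in> measurable M (count_space UNIV)" by (intro offspring_measurable) simp_all
    show "distr M (count_space UNIV) (eta (Suc k) i) = distr M (count_space UNIV) (eta 1 1)" if "1 \<le> i" for i
      using that by (intro eta_id) simp_all
    show "gwi_family Xm1 X0 xi eta eps (I_eta (Suc k) i) = eta (Suc k) i" for i by (simp add: gwi_family_def)
  qed (use d in \<open>simp_all add: gwi_indices_def meta_def f\<close>)
  have o3: "(\<lambda>x. prob (E3 x)) \<in> o[at_top](?T)"
    unfolding E3_def by (rule immigration_tail[OF _ f d(1)]) simp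
  have o4: "(\<lambda>x. prob (E4 x)) \<in> o[at_top](?T)"
  proof (cases "mxi = 0")
    case False
    hence "mxi > 0" using m_nonneg by simp
    thus ?thesis using C1 d False landau_o.small_big_trans[OF _ bigT] by (simp add: E4_def concentrated_def)
  qed (simp add: E4_def)
  have o5: "(\<lambda>x. prob (E5 x)) \<in> o[at_top](?T)"
  proof (cases "meta = 0")
    case False
    hence "meta > 0" using m_nonneg by simp
    thus ?thesis using C0 d False landau_o.small_big_trans[OF _ bigT'] by (simp add: E5_def concentrated_def)
  qed (simp add: E5_def)
  have o: "(\<lambda>x. prob (E1 x) + prob (E2 x) + prob (E3 x) + prob (E4 x) + prob (E5 x)) \<in> o[at_top](?T)"
    by (intro sum_in_smallo o1 o2 o3 o4 o5)
  have det: "\<bar>real (X (Suc (Suc k)) \<omega>) - Y (Suc (Suc k)) \<omega>\<bar> \<le> \<delta> * (x + Y (Suc (Suc k)) \<omega>)"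
    if x: "x \<ge> 0" and w: "\<omega> \<in> space M" "\<omega> \<notin> E1 x" "\<omega> \<notin> E2 x" "\<omega> \<notin> E3 x" "\<omega> \<notin> E4 x" "\<omega> \<notin> E5 x" for x \<omega>
  proof -
    define u where "u = real (X (Suc k) \<omega>)"
    define v where "v = real (X k \<omega>)"
    define y where "y = Y (Suc k) \<omega>"
    define y' where "y' = Y k \<omega>"
    have yn: "0 \<le> y" "0 \<le> y'" by (auto simp: y_def y'_def Y_nonneg)
    have b1: "\<bar>real (S1 \<omega>) - mxi * u\<bar> \<le> d * (x + mxi * u)" using w by (simp add: E1_def u_def)
    have b2: "\<bar>real (S2 \<omega>) - meta * v\<bar> \<le> d * (x + meta * v)" using w by (simp add: E2_def v_def)
    have b3: "real (eps (Suc k) \<omega>) \<le> d * x" using w by (simp add: E3_def)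
    \<comment> \<open>Multiplying through by c lets both cases be treated alike: for c = 0 nothing
      is known about s - t and nothing is needed.\<close>
    have scale: "c * \<bar>s - t\<bar> \<le> d * (c * x + c * t) \<and> c * s \<le> c * x + 2 * (c * t)"
      if c: "c \<ge> 0" and "c \<noteq> 0 \<longrightarrow> \<bar>s - t\<bar> \<le> d * (x + t)" and t: "0 \<le> t" for c s t
    proof (cases "c = 0")
      case False
      hence st: "\<bar>s - t\<bar> \<le> d * (x + t)" using that by blast
      also have "\<dots> \<le> 1 * (x + t)" using d x t by (intro mult_right_mono) auto
      finally have "s \<le> x + 2 * t" by simp
      hence "c * s \<le> c * (x + 2 * t)" using c by (rule mult_left_mono)
      moreover have "c * \<bar>s - t\<bar> \<le> c * (d * (x + t))" using st c by (rule mult_left_mono)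
      ultimately show ?thesis by (simp add: algebra_simps)
    qed auto
    have b4: "mxi * \<bar>u - y\<bar> \<le> d * (mxi * x + mxi * y)" "mxi * u \<le> mxi * x + 2 * (mxi * y)"
      using scale[of mxi u y] m_nonneg yn w by (auto simp: E4_def u_def y_def split: if_splits)
    have b5: "meta * \<bar>v - y'\<bar> \<le> d * (meta * x + meta * y')" "meta * v \<le> meta * x + 2 * (meta * y')"
      using scale[of meta v y'] m_nonneg yn w by (auto simp: E5_def v_def y'_def split: if_splits)
    have Yeq: "Y (Suc (Suc k)) \<omega> = mxi * y + meta * y'" by (simp add: Y_Suc_Suc y_def y'_def)
    have "real (X (Suc (Suc k)) \<omega>) - Y (Suc (Suc k)) \<omega> = (real (S1 \<omega>) - mxi * u) + (real (S2 \<omega>) - meta * v)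
        + real (eps (Suc k) \<omega>) + mxi * (u - y) + meta * (v - y')"
      by (simp add: Yeq S1_def S2_def algebra_simps)
    hence "\<bar>real (X (Suc (Suc k)) \<omega>) - Y (Suc (Suc k)) \<omega>\<bar> \<le> \<bar>real (S1 \<omega>) - mxi * u\<bar> + \<bar>real (S2 \<omega>) - meta * v\<bar>
        + real (eps (Suc k) \<omega>) + \<bar>mxi * (u - y)\<bar> + \<bar>meta * (v - y')\<bar>" by linarith
    also have "\<dots> \<le> d * (x + mxi * u) + d * (x + meta * v) + d * x + d * (mxi * x + mxi * y) + d * (meta * x + meta * y')"
      using b1 b2 b3 b4(1) b5(1) m_nonneg by (simp add: abs_mult)
    also have "\<dots> = d * ((x + mxi * u) + (x + meta * v) + x + (mxi * x + mxi * y) + (meta * x + meta * y'))"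
      by (simp add: algebra_simps)
    also have "\<dots> \<le> d * ((3 + 2 * mxi + 2 * meta) * x + 3 * Y (Suc (Suc k)) \<omega>)"
      using b4(2) b5(2) d by (intro mult_left_mono) (auto simp: Yeq algebra_simps)
    also have "\<dots> \<le> d * ((3 + 2 * mxi + 2 * meta) * (x + Y (Suc (Suc k)) \<omega>))"
    proof (intro mult_left_mono)
      have "3 * Y (Suc (Suc k)) \<omega> \<le> (3 + 2 * mxi + 2 * meta) * Y (Suc (Suc k)) \<omega>"
        using m_nonneg by (intro mult_right_mono Y_nonneg) auto
      thus "(3 + 2 * mxi + 2 * meta) * x + 3 * Y (Suc (Suc k)) \<omega> \<le> (3 + 2 * mxi + 2 * meta) * (x + Y (Suc (Suc k)) \<omega>)"
        by (simp add: distrib_left)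
    qed (use d in auto)
    also have "\<dots> \<le> \<delta> * (x + Y (Suc (Suc k)) \<omega>)"
      unfolding mult.assoc[symmetric] using d\<delta> x Y_nonneg by (intro mult_right_mono add_nonneg_nonneg) auto
    finally show ?thesis .
  qed
  have S_meas: "(\<lambda>\<omega>. \<Sum>i=1..X l \<omega>. z i \<omega>) \<in> measurable M (count_space UNIV)"
    if "\<And>i. 1 \<le> i \<Longrightarrow> z i \<in> measurable M (count_space UNIV)" for l and z :: "nat \<Rightarrow> 'a \<Rightarrow> nat"
  proof (rule measurable_compose_countable[where f = "\<lambda>n \<omega>. \<Sum>i=1..n. z i \<omega>"])
    show "(\<lambda>\<omega>. \<Sum>i=1..n. z i \<omega>) \<in> measurable M (count_space UNIV)" for n
      using that by (induction n) auto
  qed measurable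
  have [measurable]: "S1 \<in> measurable M (count_space UNIV)" "S2 \<in> measurable M (count_space UNIV)"
    "eps (Suc k) \<in> measurable M (count_space UNIV)"
    unfolding S1_def[abs_def] S2_def[abs_def] by (intro S_meas offspring_measurable; simp)+
  have [measurable]: "E1 x \<in> sets M" "E2 x \<in> sets M" "E3 x \<in> sets M" for x
    unfolding E1_def E2_def E3_def by measurable
  have [measurable]: "E4 x \<in> sets M" for x
    by (cases "mxi = 0") (simp_all add: E4_def)
  have [measurable]: "E5 x \<in> sets M" for x
    by (cases "meta = 0") (simp_all add: E5_def)
  show "(\<lambda>x. prob {\<omega>\<in>space M. \<bar>real (X (Suc (Suc k)) \<omega>) - Y (Suc (Suc k)) \<omega>\<bar> > \<delta> * (x + Y (Suc (Suc k)) \<omega>)}) \<in> o[at_top](?T)"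
  proof (rule smallo_mono[OF o])
    show "eventually (\<lambda>x. 0 \<le> prob {\<omega>\<in>space M. \<bar>real (X (Suc (Suc k)) \<omega>) - Y (Suc (Suc k)) \<omega>\<bar> > \<delta> * (x + Y (Suc (Suc k)) \<omega>)}
      \<and> prob {\<omega>\<in>space M. \<bar>real (X (Suc (Suc k)) \<omega>) - Y (Suc (Suc k)) \<omega>\<bar> > \<delta> * (x + Y (Suc (Suc k)) \<omega>)}
        \<le> prob (E1 x) + prob (E2 x) + prob (E3 x) + prob (E4 x) + prob (E5 x)) at_top"
      using eventually_ge_at_top[of 0]
    proof eventually_elim
      case (elim x)
      have "prob {\<omega>\<in>space M. \<bar>real (X (Suc (Suc k)) \<omega>) - Y (Suc (Suc k)) \<omega>\<bar> > \<delta> * (x + Y (Suc (Suc k)) \<omega>)}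
         \<le> prob (E1 x \<union> E2 x \<union> E3 x \<union> E4 x \<union> E5 x)"
      proof (rule finite_measure_mono)
        show "{\<omega>\<in>space M. \<bar>real (X (Suc (Suc k)) \<omega>) - Y (Suc (Suc k)) \<omega>\<bar> > \<delta> * (x + Y (Suc (Suc k)) \<omega>)}
            \<subseteq> E1 x \<union> E2 x \<union> E3 x \<union> E4 x \<union> E5 x"
          using det[OF elim] by (fastforce simp only: not_le[symmetric] Un_iff)
      qed measurable
      also have "\<dots> \<le> prob (E1 x) + prob (E2 x) + prob (E3 x) + prob (E4 x) + prob (E5 x)"
        by (intro order_trans[OF measure_Un_le] add_mono order_refl) measurable
      finally show ?case by simp
    qed
  qed
qed

lemma concentrated_of_eq:
  assumes eq: "\<And>\<omega>. real (X k \<omega>) = Y k \<omega>"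
  shows "concentrated k"
  unfolding concentrated_def
proof (intro allI impI)
  fix \<delta> :: real assume \<delta>: "\<delta> > 0"
  have "eventually (\<lambda>x. prob {\<omega>\<in>space M. \<bar>real (X k \<omega>) - Y k \<omega>\<bar> > \<delta> * (x + Y k \<omega>)} = 0) at_top"
    using eventually_ge_at_top[of 0]
  proof eventually_elim
    case (elim x)
    have "\<not> \<delta> * (x + Y k \<omega>) < 0" for \<omega>
      using \<delta> elim Y_nonneg[of k \<omega>] by (simp add: not_less)
    thus ?case by (simp add: eq)
  qed
  thus "(\<lambda>x. prob {\<omega>\<in>space M. \<bar>real (X k \<omega>) - Y k \<omega>\<bar> > \<delta> * (x + Y k \<omega>)}) \<in> o[at_top](T k)"
    by (subst landau_o.small.in_cong[where g = "\<lambda>_. 0"]) auto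
qed

lemma concentrated_all: "concentrated k"
proof (induction k rule: induct_nat_012)
  case 0
  show ?case by (rule concentrated_of_eq) (simp add: Y_def)
next
  case 1
  show ?case by (rule concentrated_of_eq) (simp add: Y_def)
next
  case (ge2 k)
  thus ?case by (intro concentrated_step)
qed

text \<open>Position \<open>Suc n\<close> is time n. There the coefficient of X_0 is m_n, and by
  \<open>lin_rec_shift\<close> that of X_(-1) is \<open>meta\<close> times m_(n-1).\<close>

lemma tail_equiv:
  assumes n: "n \<ge> 1"
  shows "(\<lambda>x. prob {\<omega>\<in>space M. real (X (Suc n) \<omega>) > x}) \<sim>[at_top]
     (\<lambda>x. mseq mxi meta n powr \<beta> * prob {\<omega>\<in>space M. real (X0 \<omega>) > x}
        + mseq mxi meta (n - 1) powr \<beta> * meta powr \<beta> * prob {\<omega>\<in>space M. real (Xm1 \<omega>) > x})"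
proof -
  obtain k where k: "n = Suc k" using n by (cases n) auto
  note lr = lin_rec_eq_mseq[OF m_nonneg m_pos]
  have "lin_rec mxi meta 1 0 (Suc n) = meta * mseq mxi meta (n - 1)"
    unfolding lin_rec_shift by (simp add: k lr)
  thus ?thesis
    using asymp_equiv_trans[OF concentrated_tail_equiv[OF concentrated_all] T_equiv[of "Suc n"]]
    by (simp only: lr powr_mult mult.commute[of "meta powr \<beta>"])
qed

lemma regvar_X: "regvar M (\<lambda>\<omega>. real (X k \<omega>)) \<beta>"
  unfolding regvar_def
  using rv_ratio_of_asymp_equiv[OF T_rv_tail concentrated_tail_equiv[OF concentrated_all]]
    rv_tailD(1)[OF T_rv_tail] by blast

end

theorem theorem3p3:
  fixes M :: "'a measure"
    and Xm1 X0 :: "'a \<Rightarrow> nat"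
    and xi eta :: "nat \<Rightarrow> nat \<Rightarrow> 'a \<Rightarrow> nat"
    and eps :: "nat \<Rightarrow> 'a \<Rightarrow> nat"
    and \<beta> r :: real
  assumes P: "prob_space M"
    and indep: "prob_space.indep_vars M (\<lambda>_. count_space UNIV)
                  (gwi_family Xm1 X0 xi eta eps) gwi_indices"
    and xi_id: "\<And>n i. 1 \<le> n \<Longrightarrow> 1 \<le> i \<Longrightarrow>
                  distr M (count_space UNIV) (xi n i) = distr M (count_space UNIV) (xi 1 1)"
    and eta_id: "\<And>n j. 1 \<le> n \<Longrightarrow> 1 \<le> j \<Longrightarrow>
                  distr M (count_space UNIV) (eta n j) = distr M (count_space UNIV) (eta 1 1)"
    and eps_id: "\<And>n. 1 \<le> n \<Longrightarrow>
                  distr M (count_space UNIV) (eps n) = distr M (count_space UNIV) (eps 1)"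
    and beta: "\<beta> \<ge> 0"
    and rv0: "regvar M (\<lambda>\<omega>. real (X0 \<omega>)) \<beta>"
    and rvm1: "regvar M (\<lambda>\<omega>. real (Xm1 \<omega>)) \<beta>"
    and r: "r > max 1 \<beta>"
    and mom_xi: "integrable M (\<lambda>\<omega>. real (xi 1 1 \<omega>) powr r)"
    and mom_eta: "integrable M (\<lambda>\<omega>. real (eta 1 1 \<omega>) powr r)"
    and mom_eps: "integrable M (\<lambda>\<omega>. real (eps 1 \<omega>) powr r)"
    and nondeg: "measure M {\<omega> \<in> space M. xi 1 1 \<omega> = 0} < 1
               \<or> measure M {\<omega> \<in> space M. eta 1 1 \<omega> = 0} < 1"
  shows "\<forall>n::nat. n \<ge> 1 \<longrightarrow>
    (let mxi = integral\<^sup>L M (\<lambda>\<omega>. real (xi 1 1 \<omega>));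
         meta = integral\<^sup>L M (\<lambda>\<omega>. real (eta 1 1 \<omega>));
         Xn = gwi_X Xm1 X0 xi eta eps (int n)
     in ((\<lambda>x. measure M {\<omega> \<in> space M. real (Xn \<omega>) > x})
          \<sim>[at_top] (\<lambda>x. mseq mxi meta n powr \<beta> * measure M {\<omega> \<in> space M. real (X0 \<omega>) > x}
              + mseq mxi meta (n - 1) powr \<beta> * meta powr \<beta>
                  * measure M {\<omega> \<in> space M. real (Xm1 \<omega>) > x}))
        \<and> regvar M (\<lambda>\<omega>. real (Xn \<omega>)) \<beta>)"
proof -
  interpret prob_space M by (rule P)
  interpret second_order_gwi M Xm1 X0 xi eta eps \<beta> r
    by unfold_locales (fact indep xi_id eta_id eps_id rv0 rvm1 r mom_xi mom_eta mom_eps nondeg)+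
  \<comment> \<open>Time n occupies position n + 1 of the shifted process.\<close>
  have gwi: "gwi_X Xm1 X0 xi eta eps (int n) = gwi_shift Xm1 X0 xi eta eps (Suc n)" for n
    by (simp add: gwi_X_def nat_add_distrib)
  show ?thesis
    unfolding Let_def gwi using tail_equiv regvar_X by (simp only: mxi_def meta_def) blast
qed

end
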